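(* Suppose that $f$ is coercive, i.e. $\liminf_{\|x\|\to\infty} f(x)/\|x\|=\infty$. Let $\{(\bar x^j,\bar w^j)\}_{j\in\mathbb N}$ be the sequence generated by the semismooth Newton algorithm SNA applied to the problems $(P_k)$ and $(D_k)$ described in the context. Then this sequence is bounded and the following assertions hold. (i) Each accumulation point of $\{\bar x^j\}_{j\in\mathbb N}$ is a global minimizer of $(P_k)$. Moreover, $$\lim_{j\to\infty}\|\nabla\Psi_k(\bar x^j)\|=0\quad\text{and}\quad \lim_{j\to\infty}\Psi_k(\bar x^j)=\min\Psi_k .$$ (ii) The sequence of duality gaps $\{G_k(\bar x^j,\bar w^j)\}_{j\in\mathbb N}$ converges to $0$. (iii) $\{\bar w^j\}_{j\in\mathbb N}$ converges to the unique global minimizer of $(D_k)$, and $\lim_{j\to\infty}\Xi_k(\bar w^j)$ equals the optimal value of $(D_k)$, i.e. $\min\{\Xi_k(w): w=[y;z],\ z_{\overline{T}_k}=0\}$.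
   Context: **Data.** $f:\mathbb R^n\to(-\infty,\infty]$ and $g:\mathbb R^m\to(-\infty,\infty]$ are proper, closed, convex; $A:\mathbb R^n\to\mathbb R^m$ and $B:\mathbb R^n\to\mathbb R^p$ are linear (identified with matrices); $Qx:=[Ax;Bx]\in\mathbb R^{m+p}$; $M:=QQ^\top+I$; $\|w\|_M^2:=\langle w,Mw\rangle$. Vectors of $\mathbb R^{m+p}$ are written $w=[y;z]$ with $y\in\mathbb R^m$, $z\in\mathbb R^p$. $f^*,g^*$ are the Fenchel conjugates. $\mu\in\mathbb R^p$ has positive entries. For $T\subseteq[p]=\{1,\dots,p\}$, $\overline T=[p]\setminus T$, $z_T$ is the subvector of $z$ indexed by $T$, $B_{T:}$ the submatrix of rows indexed by $T$. For $\sigma>0$ and $\psi$ proper closed convex, $\mathcal E_{\sigma\psi}(p)=\min_x\{\frac1{2\sigma}\|x-p\|^2+\psi(x)\}$ and $\mathrm{Prox}_{\sigma\psi}(p)$ is the unique minimizer. **Subproblems.** Let $x^k\in\mathbb R^n$ and $w^k=[y^k;z^k]\in\mathbb R^{m+p}$ be the current primal and dual iterates of the outer proximal point algorithm for $\min_{w=[y;z]}\Xi(w)+\sum_{i=1}^p\mu_i\mathbb 1_{\{z_i\neq0\}}$, where $\Xi(w)=f^*(-Q^\top w)+g^*(y)$; let $\gamma_k>0$ and $$\Xi_k(w)=\Xi(w)+\tfrac1{2\gamma_k}\|w-w^k\|_M^2 .$$ The point $\tilde z^k\in\mathbb R^p$ is obtained by one cycle of coordinate minimization: successively for $i=1,\dots,p$,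 $\tilde z_i^k\in\operatorname{argmin}_{t\in\mathbb R}\ \Xi_k(y^k,\tilde z^k_1,\dots,\tilde z^k_{i-1},t,z^k_{i+1},\dots,z^k_p)+\mu_i\mathbb 1_{\{t\ne0\}}$. Put $\tilde w^k=[y^k;\tilde z^k]$ and $T_k=\{i\in[p]:\tilde z^k_i\ne0\}$. $(D_k)$ is the problem of minimizing $\Xi_k(w)$ over $w=[y;z]$ subject to $z_{\overline T_k}=0$. $(P_k)$ is the problem of minimizing over $x\in\mathbb R^n$ $$\Psi_k(x)=f_k(x)+g_k(Ax)+h_k(Bx),$$ where $f_k(x)=\mathcal E_{\frac1{\gamma_k}f}(x-Q^\top w^k/\gamma_k)-\frac1{2\gamma_k}\|Q^\top w^k\|^2$, $g_k(u)=\mathcal E_{\frac1{\gamma_k}g}(u+y^k/\gamma_k)-\frac1{2\gamma_k}\|y^k\|^2$, $h_k(v)=\frac{\gamma_k}2\|(v+z^k/\gamma_k)_{T_k}\|^2-\frac1{2\gamma_k}\|z^k\|^2$. These are convex with $\gamma_k$-Lipschitz gradients. The duality gap is $G_k(x,w)=\Psi_k(x)+\Xi_k(w)$. **Generalized Hessian.** $\widehat\partial^2\Psi_k(x)=\partial^2f_k(x)+A^\top\partial^2g_k(Ax)A+\gamma_kB_{T_k:}^\top B_{T_k:}$ (a set of matrices), where $\partial^2 f_k,\partial^2 g_k$ are the Clarke generalized Jacobians of $\nabla f_k,\nabla g_k$. **Algorithm SNA.** Parameters $\tau\in(0,1]$, $\tau_1,\tau_2,\beta\in(0,1)$, $\zeta\in(0,1/2)$;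 starting point $(\bar x^0,\bar w^0)=(x^k,\tilde w^k)$. For $j=0,1,\dots$: 1. Newton direction: compute $H_j\in\widehat\partial^2\Psi_k(\bar x^j)$ and $\theta_j=\tau_1\|\nabla\Psi_k(\bar x^j)\|$. Apply the conjugate gradient method to find an approximate solution $d^j$ to $(H_j+\theta_jI)d=-\nabla\Psi_k(\bar x^j)$ such that $\|(H_j+\theta_jI)d^j+\nabla\Psi_k(\bar x^j)\|\le\tau_2\|\nabla\Psi_k(\bar x^j)\|^{1+\tau}$. 2. Line search: set $\alpha_j=\beta^{q_j}$ with $q_j$ the smallest nonnegative integer $q$ such that $\Psi_k(\bar x^j+\beta^qd^j)\le\Psi_k(\bar x^j)+\zeta\beta^q\langle\nabla\Psi_k(\bar x^j),d^j\rangle$; set $\bar x^{j+1}=\bar x^j+\alpha_jd^j$. 3. Dual recovery: update $\bar w^j=[\bar y^j;\bar z^j]$ by $\bar y^j=\mathrm{Prox}_{\gamma_kg^*}(\gamma_kA\bar x^j+y^k)$, $\bar z^j_{T_k}=z^k_{T_k}+\gamma_kB_{T_k:}\bar x^j$, $\bar z^j_{\overline T_k}=0$. The theorem concerns the infinite sequence indexed by $j\in\mathbb N$, i.e. the algorithm without its stopping test.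
   Formalization: The conjugate gradient method is taken to start at zero and to make at least one step; otherwise, for a large gradient, d = 0 already meets the tolerance τ₂‖∇Ψ_k‖^{1+τ} and the algorithm may stall at a non-minimizer. *)

theory Defs
  imports "HOL-Analysis.Analysis"
begin

subsection \<open>Convex analysis of extended real-valued functions\<close>

definition epi :: "('a::real_normed_vector \<Rightarrow> ereal) \<Rightarrow> ('a \<times> real) set" where
  "epi f = {(x, r). f x \<le> ereal r}"

definition proper_fun :: "('a \<Rightarrow> ereal) \<Rightarrow> bool" where
  "proper_fun f \<longleftrightarrow> (\<forall>x. f x \<noteq> -\<infinity>) \<and> (\<exists>x. f x \<noteq> \<infinity>)"

definition proper_closed_convex :: "('a::real_normed_vector \<Rightarrow> ereal) \<Rightarrow> bool" where
  "proper_closed_convex f \<longleftrightarrow> proper_fun f \<and> closed (epi f) \<and> convex (epi f)"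

definition fenchel_conj :: "('a::real_inner \<Rightarrow> ereal) \<Rightarrow> 'a \<Rightarrow> ereal" where
  "fenchel_conj f s = (SUP x. ereal (s \<bullet> x) - f x)"

definition coercive_fun :: "('a::real_normed_vector \<Rightarrow> ereal) \<Rightarrow> bool" where
  "coercive_fun f \<longleftrightarrow> Liminf at_infinity (\<lambda>x. f x / ereal (norm x)) = \<infinity>"

definition argmins :: "('a \<Rightarrow> 'b::ord) \<Rightarrow> 'a set \<Rightarrow> 'a set" where
  "argmins F S = {x \<in> S. \<forall>y \<in> S. F x \<le> F y}"

definition prox_obj :: "real \<Rightarrow> ('a::real_normed_vector \<Rightarrow> ereal) \<Rightarrow> 'a \<Rightarrow> 'a \<Rightarrow> ereal" where
  "prox_obj \<sigma> \<psi> p x = ereal (1 / (2 * \<sigma>) * (norm (x - p))\<^sup>2) + \<psi> x"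

text \<open>The infimum is attained and finite when \<open>\<psi>\<close> is proper, closed and convex and
  \<open>\<sigma> > 0\<close>, so that the conversion to a real number loses nothing.\<close>

definition moreau_env :: "real \<Rightarrow> ('a::real_normed_vector \<Rightarrow> ereal) \<Rightarrow> 'a \<Rightarrow> real" where
  "moreau_env \<sigma> \<psi> p = real_of_ereal (INF x. prox_obj \<sigma> \<psi> p x)"

definition prox :: "real \<Rightarrow> ('a::real_normed_vector \<Rightarrow> ereal) \<Rightarrow> 'a \<Rightarrow> 'a" where
  "prox \<sigma> \<psi> p = (THE u. u \<in> argmins (prox_obj \<sigma> \<psi> p) UNIV)"

definition grad :: "('a::real_inner \<Rightarrow> real) \<Rightarrow> 'a \<Rightarrow> 'a" where
  "grad F x = (THE D. GDERIV F x :> D)"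

definition clarke_jacobian :: "(real^'n \<Rightarrow> real^'m) \<Rightarrow> real^'n \<Rightarrow> (real^'n^'m) set" where
  "clarke_jacobian F x = convex hull
     {V. \<exists>xs. xs \<longlonglongrightarrow> x \<and> (\<forall>i. F differentiable at (xs i)) \<and>
              (\<lambda>i. jacobian F (at (xs i))) \<longlonglongrightarrow> V}"


subsection \<open>The primal and dual subproblems\<close>

text \<open>A vector \<open>[y; z]\<close> of \<open>\<real>\<^sup>m\<^sup>+\<^sup>p\<close> is the pair \<open>(y, z)\<close>; the inner product of the product
  type is the standard one. A subvector \<open>z\<^sub>T\<close> and a row submatrix \<open>B\<^sub>T\<close> keep their full index type,
  with zeros outside \<open>T\<close>; the expressions formed with them below (norms, \<open>B\<^sub>T x\<close>, and the product
  of the transpose of \<open>B\<^sub>T\<close> with \<open>B\<^sub>T\<close>) are the same, up to zero padding.\<close>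

definition restr :: "'p set \<Rightarrow> real^'p \<Rightarrow> real^'p" where
  "restr T z = (\<chi> i. if i \<in> T then z $ i else 0)"

definition rows_on :: "'p set \<Rightarrow> real^'n^'p \<Rightarrow> real^'n^'p" where
  "rows_on T B = (\<chi> i. if i \<in> T then B $ i else 0)"

definition Qmap :: "real^'n^'m \<Rightarrow> real^'n^'p \<Rightarrow> real^'n \<Rightarrow> (real^'m) \<times> (real^'p)" where
  "Qmap A B x = (A *v x, B *v x)"

definition QT :: "real^'n^'m \<Rightarrow> real^'n^'p \<Rightarrow> (real^'m) \<times> (real^'p) \<Rightarrow> real^'n" where
  "QT A B = adjoint (Qmap A B)"

definition Mmap :: "real^'n^'m \<Rightarrow> real^'n^'p \<Rightarrow> (real^'m) \<times> (real^'p) \<Rightarrow> (real^'m) \<times> (real^'p)" where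
  "Mmap A B w = Qmap A B (QT A B w) + w"

definition Xi :: "(real^'n \<Rightarrow> ereal) \<Rightarrow> (real^'m \<Rightarrow> ereal) \<Rightarrow> real^'n^'m \<Rightarrow> real^'n^'p \<Rightarrow>
    (real^'m) \<times> (real^'p) \<Rightarrow> ereal" where
  "Xi f g A B w = fenchel_conj f (- QT A B w) + fenchel_conj g (fst w)"

definition Xi_k :: "(real^'n \<Rightarrow> ereal) \<Rightarrow> (real^'m \<Rightarrow> ereal) \<Rightarrow> real^'n^'m \<Rightarrow> real^'n^'p \<Rightarrow>
    real \<Rightarrow> (real^'m) \<times> (real^'p) \<Rightarrow> (real^'m) \<times> (real^'p) \<Rightarrow> ereal" where
  "Xi_k f g A B \<gamma> wk w =
     Xi f g A B w + ereal (1 / (2 * \<gamma>) * ((w - wk) \<bullet> Mmap A B (w - wk)))"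

definition D_feasible :: "'p set \<Rightarrow> ((real^'m) \<times> (real^'p)) set" where
  "D_feasible T = {(y, z). \<forall>i. i \<notin> T \<longrightarrow> z $ i = 0}"

definition f_k :: "(real^'n \<Rightarrow> ereal) \<Rightarrow> real^'n^'m \<Rightarrow> real^'n^'p \<Rightarrow> real \<Rightarrow>
    (real^'m) \<times> (real^'p) \<Rightarrow> real^'n \<Rightarrow> real" where
  "f_k f A B \<gamma> wk x =
     moreau_env (1 / \<gamma>) f (x - QT A B wk /\<^sub>R \<gamma>) - 1 / (2 * \<gamma>) * (norm (QT A B wk))\<^sup>2"

definition g_k :: "(real^'m \<Rightarrow> ereal) \<Rightarrow> real \<Rightarrow> real^'m \<Rightarrow> real^'m \<Rightarrow> real" where
  "g_k g \<gamma> yk u = moreau_env (1 / \<gamma>) g (u + yk /\<^sub>R \<gamma>) - 1 / (2 * \<gamma>) * (norm yk)\<^sup>2"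

definition h_k :: "real \<Rightarrow> real^'p \<Rightarrow> 'p set \<Rightarrow> real^'p \<Rightarrow> real" where
  "h_k \<gamma> zk T v = \<gamma> / 2 * (norm (restr T (v + zk /\<^sub>R \<gamma>)))\<^sup>2 - 1 / (2 * \<gamma>) * (norm zk)\<^sup>2"

definition Psi_k :: "(real^'n \<Rightarrow> ereal) \<Rightarrow> (real^'m \<Rightarrow> ereal) \<Rightarrow> real^'n^'m \<Rightarrow> real^'n^'p \<Rightarrow>
    real \<Rightarrow> (real^'m) \<times> (real^'p) \<Rightarrow> 'p set \<Rightarrow> real^'n \<Rightarrow> real" where
  "Psi_k f g A B \<gamma> wk T x =
     f_k f A B \<gamma> wk x + g_k g \<gamma> (fst wk) (A *v x) + h_k \<gamma> (snd wk) T (B *v x)"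

definition gen_hessian :: "(real^'n \<Rightarrow> ereal) \<Rightarrow> (real^'m \<Rightarrow> ereal) \<Rightarrow> real^'n^'m \<Rightarrow> real^'n^'p \<Rightarrow>
    real \<Rightarrow> (real^'m) \<times> (real^'p) \<Rightarrow> 'p set \<Rightarrow> real^'n \<Rightarrow> (real^'n^'n) set" where
  "gen_hessian f g A B \<gamma> wk T x =
     {U + transpose A ** V ** A + \<gamma> *\<^sub>R (transpose (rows_on T B) ** rows_on T B) | U V.
        U \<in> clarke_jacobian (grad (f_k f A B \<gamma> wk)) x \<and>
        V \<in> clarke_jacobian (grad (g_k g \<gamma> (fst wk))) (A *v x)}"

definition duality_gap :: "(real^'n \<Rightarrow> ereal) \<Rightarrow> (real^'m \<Rightarrow> ereal) \<Rightarrow> real^'n^'m \<Rightarrow> real^'n^'p \<Rightarrow>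
    real \<Rightarrow> (real^'m) \<times> (real^'p) \<Rightarrow> 'p set \<Rightarrow> real^'n \<Rightarrow> (real^'m) \<times> (real^'p) \<Rightarrow> ereal" where
  "duality_gap f g A B \<gamma> wk T x w = ereal (Psi_k f g A B \<gamma> wk T x) + Xi_k f g A B \<gamma> wk w"

text \<open>One cycle of coordinate minimization over \<open>z\<close>, in the order of the index type.\<close>

definition coord_min_cycle :: "((real^'m) \<times> (real^('p::{finite,linorder})) \<Rightarrow> ereal) \<Rightarrow> real^('p::{finite,linorder}) \<Rightarrow>
    (real^'m) \<times> (real^('p::{finite,linorder})) \<Rightarrow> real^('p::{finite,linorder}) \<Rightarrow> bool" where
  "coord_min_cycle F \<mu> wk zt \<longleftrightarrow>
     (\<forall>i. zt $ i \<in> argmins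
        (\<lambda>t. F (fst wk, \<chi> l. if l < i then zt $ l else if l = i then t else snd wk $ l)
              + ereal (\<mu> $ i * (if t \<noteq> 0 then 1 else 0))) UNIV)"


subsection \<open>The semismooth Newton algorithm\<close>

text \<open>The conjugate gradient method for \<open>V d = b\<close>, started at zero. A state is the triple of current
  approximation, residual \<open>b - V d\<close> and search direction. Once the residual vanishes the quotients
  are \<open>0 / 0 = 0\<close>, so the approximation stays at the exact solution.\<close>

primrec cg_state :: "real^'n^'n \<Rightarrow> real^'n \<Rightarrow> nat \<Rightarrow> (real^'n) \<times> (real^'n) \<times> (real^'n)" where
  "cg_state V b 0 = (0, b, b)"
| "cg_state V b (Suc i) =
     (case cg_state V b i of (d, r, s) \<Rightarrow>
        let a = (r \<bullet> r) / (s \<bullet> (V *v s));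
            r' = r - a *\<^sub>R (V *v s)
        in (d + a *\<^sub>R s, r', r' + ((r' \<bullet> r') / (r \<bullet> r)) *\<^sub>R s))"

definition cg_iterate :: "real^'n^'n \<Rightarrow> real^'n \<Rightarrow> nat \<Rightarrow> real^'n" where
  "cg_iterate V b i = fst (cg_state V b i)"

text \<open>At least one conjugate gradient step is taken: for a large gradient \<open>G\<close> the tolerance
  \<open>\<tau>\<^sub>2 \<parallel>G\<parallel>\<^sup>1\<^sup>+\<^sup>\<tau>\<close> exceeds \<open>\<parallel>G\<parallel>\<close>, and the trivial approximation
  \<open>0\<close> would be accepted and the algorithm would not move.\<close>

definition newton_direction :: "real^'n^'n \<Rightarrow> real^'n \<Rightarrow> real \<Rightarrow> real \<Rightarrow> real \<Rightarrow> real^'n \<Rightarrow> bool" where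
  "newton_direction H G \<tau> \<tau>1 \<tau>2 d \<longleftrightarrow>
     (let V = H + (\<tau>1 * norm G) *\<^sub>R mat 1
      in (\<exists>i\<ge>1. d = cg_iterate V (- G) i) \<and>
         norm (V *v d + G) \<le> \<tau>2 * norm G powr (1 + \<tau>))"

definition armijo_step :: "(real^'n \<Rightarrow> real) \<Rightarrow> real \<Rightarrow> real \<Rightarrow> real^'n \<Rightarrow> real^'n \<Rightarrow> real" where
  "armijo_step F \<beta> \<zeta> x d =
     \<beta> ^ (LEAST q. F (x + \<beta> ^ q *\<^sub>R d) \<le> F x + \<zeta> * \<beta> ^ q * (grad F x \<bullet> d))"

definition dual_recovery :: "(real^'m \<Rightarrow> ereal) \<Rightarrow> real^'n^'m \<Rightarrow> real^'n^'p \<Rightarrow> real \<Rightarrow>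
    (real^'m) \<times> (real^'p) \<Rightarrow> 'p set \<Rightarrow> real^'n \<Rightarrow> (real^'m) \<times> (real^'p)" where
  "dual_recovery g A B \<gamma> wk T x =
     (prox \<gamma> (fenchel_conj g) (\<gamma> *\<^sub>R (A *v x) + fst wk),
      restr T (snd wk) + \<gamma> *\<^sub>R (rows_on T B *v x))"

text \<open>The initial dual point is overwritten by the recovery step of the iteration \<open>j = 0\<close>; the
  sequence may record either value at index \<open>0\<close>.\<close>

definition SNA_sequence :: "(real^'n \<Rightarrow> ereal) \<Rightarrow> (real^'m \<Rightarrow> ereal) \<Rightarrow> real^'n^'m \<Rightarrow> real^'n^'p \<Rightarrow>
    real \<Rightarrow> (real^'m) \<times> (real^'p) \<Rightarrow> 'p set \<Rightarrow>
    real \<Rightarrow> real \<Rightarrow> real \<Rightarrow> real \<Rightarrow> real \<Rightarrow>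
    real^'n \<Rightarrow> (real^'m) \<times> (real^'p) \<Rightarrow>
    (nat \<Rightarrow> real^'n) \<Rightarrow> (nat \<Rightarrow> (real^'m) \<times> (real^'p)) \<Rightarrow> bool" where
  "SNA_sequence f g A B \<gamma> wk T \<tau> \<tau>1 \<tau>2 \<beta> \<zeta> x0 w0 xbar wbar \<longleftrightarrow>
     (let \<Psi> = Psi_k f g A B \<gamma> wk T in
        xbar 0 = x0 \<and>
        (\<forall>j. \<exists>H d. H \<in> gen_hessian f g A B \<gamma> wk T (xbar j) \<and>
                   newton_direction H (grad \<Psi> (xbar j)) \<tau> \<tau>1 \<tau>2 d \<and>
                   xbar (Suc j) = xbar j + armijo_step \<Psi> \<beta> \<zeta> (xbar j) d *\<^sub>R d) \<and>
        (wbar 0 = w0 \<or> wbar 0 = dual_recovery g A B \<gamma> wk T (xbar 0)) \<and>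
        (\<forall>j\<ge>1. wbar j = dual_recovery g A B \<gamma> wk T (xbar j)))"

end

theory Submission
  imports Defs
begin

text \<open>\<open>\<Psi>\<close> is convex with Lipschitz gradient, its level sets are bounded because \<open>f\<close> is superlinear,
  and the generalized Hessians are symmetric, positive semidefinite and uniformly bounded. The
  energy decrease of conjugate gradients gives \<open>-\<langle>G, d\<rangle> \<ge> c\<parallel>G\<parallel>\<^sup>2\<close> for the gradient \<open>G\<close>, and the
  regularization \<open>\<tau>\<^sub>1\<parallel>G\<parallel>\<close> gives \<open>\<parallel>d\<parallel> \<le> 2/\<tau>\<^sub>1\<close>; so the line search
  decreases \<open>\<Psi>\<close> by at least a fixed increasing function of \<open>\<parallel>G\<parallel>\<close>, and \<open>G\<close> tends to zero. At the recovered
  dual point the duality gap equals \<open>\<phi>(v - G) - \<phi>(v) + \<langle>q, G\<rangle>\<close>, where \<open>\<phi>\<close> is a finite convex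
  function and \<open>v\<close>, \<open>q\<close> stay bounded, so it tends to zero as well. Strong convexity of \<open>\<Xi>\<^sub>k\<close> turns this
  into convergence of the dual points.\<close>

subsection \<open>Convex functions with Lipschitz gradient\<close>

text \<open>Descent comes from how \<open>d\<close> arises: the first conjugate gradient step is
  exact steepest descent for the Newton model, and later steps never raise that model. The
  guaranteed decrease depends on a bound for |G| that is unknown in advance; so monotonicity is
  proved with pointwise constants, it confines the iterates to a level set, and only then do uniform
  constants exist.

  Coercivity acts twice: it bounds the level sets, and it makes f^* finite everywhere, hence
  continuous. The second matters because a recovered w satisfies -Q^T w = v - G with v the gradient
  of f_k, so f^* is evaluated away from the point \<open>v\<close> where Fenchel-Young is an
  equality. The points v need not converge; boundedness and uniform continuity on a ball replace
  that.

  Strong duality is a result here: an accumulation point x with zero gradient has gap zero together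
  with its recovered dual point, which certifies both optima. The x-iterates may have many
  accumulation points, while M >= I makes the dual minimizer unique.\<close>

definition smooth_convex :: "real \<Rightarrow> ('a::real_inner \<Rightarrow> real) \<Rightarrow> ('a \<Rightarrow> 'a) \<Rightarrow> bool" where
  "smooth_convex L F D \<longleftrightarrow> (\<forall>x y. F x + D x \<bullet> (y - x) \<le> F y \<and>
     F y \<le> F x + D x \<bullet> (y - x) + L / 2 * (norm (y - x))\<^sup>2)"

lemma smooth_convexD:
  assumes "smooth_convex L F D"
  shows "F x + D x \<bullet> (y - x) \<le> F y"
    and "F y \<le> F x + D x \<bullet> (y - x) + L / 2 * (norm (y - x))\<^sup>2"
  using assms unfolding smooth_convex_def by auto

text \<open>Tangent below, quadratic majorant above: this pair of inequalities is preserved by sums,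
  translations and linear substitution without differentiating anything, so \<Psi> and its gradient
  can be assembled from the three summands.\<close>

lemma smooth_convex_add:
  assumes "smooth_convex L F D" "smooth_convex L' F' D'"
  shows "smooth_convex (L + L') (\<lambda>x. F x + F' x) (\<lambda>x. D x + D' x)"
  unfolding smooth_convex_def
proof (intro allI)
  fix x y
  show "F x + F' x + (D x + D' x) \<bullet> (y - x) \<le> F y + F' y \<and>
    F y + F' y \<le> F x + F' x + (D x + D' x) \<bullet> (y - x) + (L + L') / 2 * (norm (y - x))\<^sup>2"
    using smooth_convexD(1)[OF assms(1), of x y] smooth_convexD(1)[OF assms(2), of x y]
      smooth_convexD(2)[OF assms(1), of y x] smooth_convexD(2)[OF assms(2), of y x]
    by (simp add: inner_add_left algebra_simps add_divide_distrib)
qed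

lemma smooth_convex_add_const:
  assumes "smooth_convex L F D"
  shows "smooth_convex L (\<lambda>x. F x + c) D"
  using assms unfolding smooth_convex_def by (simp add: algebra_simps)

lemma smooth_convex_shift:
  assumes "smooth_convex L F D"
  shows "smooth_convex L (\<lambda>x. F (x + a)) (\<lambda>x. D (x + a))"
  unfolding smooth_convex_def
proof (intro allI)
  fix x y
  show "F (x + a) + D (x + a) \<bullet> (y - x) \<le> F (y + a) \<and>
    F (y + a) \<le> F (x + a) + D (x + a) \<bullet> (y - x) + L / 2 * (norm (y - x))\<^sup>2"
    using smooth_convexD(1)[OF assms, of "x + a" "y + a"] smooth_convexD(2)[OF assms, of "y + a" "x + a"] by simp
qed

lemma smooth_convex_compose:
  assumes F: "smooth_convex L F D" and A: "linear A"
    and K: "\<And>x. norm (A x) \<le> K * norm x" and L: "L \<ge> 0"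
    and adj: "\<And>x u. A' u \<bullet> x = u \<bullet> A x"
  shows "smooth_convex (L * K\<^sup>2) (\<lambda>x. F (A x)) (\<lambda>x. A' (D (A x)))"
  unfolding smooth_convex_def
proof (intro allI)
  fix x y
  have "(norm (A (y - x)))\<^sup>2 \<le> K\<^sup>2 * (norm (y - x))\<^sup>2"
    using power_mono[OF K[of "y - x"], of 2] by (simp add: power_mult_distrib)
  then have "L / 2 * (norm (A (y - x)))\<^sup>2 \<le> L * K\<^sup>2 / 2 * (norm (y - x))\<^sup>2"
    using mult_left_mono[of _ _ "L / 2"] L by (fastforce simp: mult.assoc)
  then show "F (A x) + A' (D (A x)) \<bullet> (y - x) \<le> F (A y) \<and>
    F (A y) \<le> F (A x) + A' (D (A x)) \<bullet> (y - x) + L * K\<^sup>2 / 2 * (norm (y - x))\<^sup>2"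
    using smooth_convexD(1)[OF F, of "A x" "A y"] smooth_convexD(2)[OF F, of "A y" "A x"]
    by (simp add: adj linear_diff[OF A, symmetric])
qed

text \<open>The linearization error lies between 0 and
  \<open>L / 2 * (norm (y - x))\<^sup>2\<close>, so its quotient by the distance vanishes.\<close>

lemma smooth_convex_gderiv:
  assumes "smooth_convex L F D"
  shows "GDERIV F x :> D x"
proof -
  have "(\<lambda>y. L / 2 * norm (y - x)) \<midarrow>x\<rightarrow> L / 2 * norm (x - x)"
    by (intro tendsto_intros)
  then have lim: "(\<lambda>y. L / 2 * norm (y - x)) \<midarrow>x\<rightarrow> 0" by simp
  have "(\<lambda>y. norm (F y - F x - (y - x) \<bullet> D x) / norm (y - x)) \<midarrow>x\<rightarrow> 0"
  proof (rule tendsto_sandwich[OF _ _ tendsto_const lim])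
    show "\<forall>\<^sub>F y in at x. norm (F y - F x - (y - x) \<bullet> D x) / norm (y - x) \<le> L / 2 * norm (y - x)"
      unfolding eventually_at_filter
    proof (intro always_eventually allI impI)
      fix y assume "y \<noteq> x"
      have "norm (F y - F x - (y - x) \<bullet> D x) \<le> L / 2 * (norm (y - x))\<^sup>2"
        using smooth_convexD(1)[OF assms, of x y] smooth_convexD(2)[OF assms, of y x] by (simp add: inner_commute)
      then show "norm (F y - F x - (y - x) \<bullet> D x) / norm (y - x) \<le> L / 2 * norm (y - x)"
        using \<open>y \<noteq> x\<close> by (simp add: pos_divide_le_eq power2_eq_square mult.assoc)
    qed
  qed simp
  then show ?thesis
    unfolding gderiv_def has_derivative_iff_norm
    by (simp add: bounded_linear_inner_left)
qed

lemma grad_eq: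
  assumes "GDERIV F x :> D"
  shows "grad F x = D"
  unfolding grad_def
proof (rule the_equality)
  show "GDERIV F x :> D" by fact
next
  fix D' assume "GDERIV F x :> D'"
  then have "(\<lambda>h. h \<bullet> D') = (\<lambda>h. h \<bullet> D)"
    using assms unfolding gderiv_def by (rule has_derivative_unique)
  then have "(D' - D) \<bullet> D' = (D' - D) \<bullet> D" by metis
  then show "D' = D"
    by (metis inner_diff_right inner_eq_zero_iff right_minus_eq)
qed

lemma grad_smooth_convex:
  assumes "smooth_convex L F D"
  shows "grad F = D"
  using grad_eq[OF smooth_convex_gderiv[OF assms]] by blast

text \<open>The tangent at \<open>x\<close> stays below the quadratic majorant at \<open>y\<close>.
  The point \<open>z\<close> is where the difference of the two is smallest, and there the
  comparison yields the extra square.\<close>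

lemma smooth_convex_cocoercive:
  assumes F: "smooth_convex L F D" and L: "L > 0"
  shows "F x + D x \<bullet> (y - x) + 1 / (2 * L) * (norm (D y - D x))\<^sup>2 \<le> F y"
proof -
  define e where "e = D y - D x"
  define z where "z = y - (1 / L) *\<^sub>R e"
  have "F x + D x \<bullet> (z - x) \<le> F y + D y \<bullet> (z - y) + L / 2 * (norm (z - y))\<^sup>2"
    using smooth_convexD(1)[OF F, of x z] smooth_convexD(2)[OF F, of z y] by linarith
  moreover have "D x \<bullet> (z - x) - D y \<bullet> (z - y) = D x \<bullet> (y - x) + (1 / L) * (e \<bullet> e)"
  proof -
    have "D x \<bullet> (z - x) - D y \<bullet> (z - y) = D x \<bullet> (y - x) + (D x - D y) \<bullet> (z - y)"
      by (simp add: inner_diff_left inner_diff_right)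
    also have "(D x - D y) \<bullet> (z - y) = (1 / L) * (e \<bullet> e)"
      by (simp add: z_def e_def inner_diff_left inner_diff_right diff_divide_distrib)
    finally show ?thesis .
  qed
  moreover have "L / 2 * (norm (z - y))\<^sup>2 = 1 / (2 * L) * (e \<bullet> e)"
    using L by (simp add: z_def power_mult_distrib power_divide dot_square_norm field_simps power2_eq_square)
  moreover have "(1 / L) * (e \<bullet> e) = 1 / (2 * L) * (e \<bullet> e) + 1 / (2 * L) * (e \<bullet> e)"
    using L by (simp add: field_simps)
  ultimately show ?thesis
    by (simp only: e_def[symmetric] power2_norm_eq_inner)
qed

lemma smooth_convex_minimizer_iff:
  assumes F: "smooth_convex L F D" and L: "L > 0"
  shows "x \<in> argmins F UNIV \<longleftrightarrow> D x = 0"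
proof
  assume "D x = 0"
  then show "x \<in> argmins F UNIV"
    using smooth_convexD(1)[OF F, of x] by (simp add: argmins_def)
next
  assume x: "x \<in> argmins F UNIV"
  \<comment> \<open>A gradient step of length 1/L lowers F by at least |D x|^2 / (2 L), which a
    minimizer permits only if \<open>D x = 0\<close>.\<close>
  define z where "z = x - (1 / L) *\<^sub>R D x"
  have "F x \<le> F z" using x by (simp add: argmins_def)
  also have "\<dots> \<le> F x + D x \<bullet> (z - x) + L / 2 * (norm (z - x))\<^sup>2"
    by (rule smooth_convexD(2)[OF F])
  also have "\<dots> = F x - 1 / (2 * L) * (norm (D x))\<^sup>2"
  proof -
    have "D x \<bullet> (z - x) = - (1 / L) * (norm (D x))\<^sup>2" "(norm (z - x))\<^sup>2 = (norm (D x))\<^sup>2 / L\<^sup>2"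
      using L by (simp_all add: z_def power_divide dot_square_norm)
    then show ?thesis using L by (simp add: power2_eq_square)
  qed
  finally have "(norm (D x))\<^sup>2 / (2 * L) \<le> 0" by simp
  then show "D x = 0" using L by (simp add: divide_le_0_iff)
qed

lemma smooth_convex_lipschitz:
  assumes F: "smooth_convex L F D" and L: "L > 0"
  shows "norm (D y - D x) \<le> L * norm (y - x)"
proof (cases "D y = D x")
  case False
  have "1 / (2 * L) * (norm (D y - D x))\<^sup>2 \<le> L / 2 * (norm (y - x))\<^sup>2"
    using smooth_convex_cocoercive[OF F L, of x y] smooth_convexD(2)[OF F, of y x] by linarith
  then have "(norm (D y - D x))\<^sup>2 \<le> (L * norm (y - x))\<^sup>2"
    using L by (simp add: divide_le_eq power_mult_distrib power2_eq_square mult_ac)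
  then show ?thesis by (rule power2_le_imp_le) (use L in simp)
qed (use L in simp)

lemma smooth_convex_continuous:
  assumes F: "smooth_convex L F D" and L: "L > 0"
  shows "continuous_on S D"
proof (rule continuous_on_subset)
  show "continuous_on UNIV D"
    by (rule lipschitz_on_continuous_on[where L = L])
      (use L in \<open>auto intro!: lipschitz_onI smooth_convex_lipschitz[OF F] simp: dist_norm\<close>)
qed simp

lemma smooth_convex_inner_diff:
  assumes F: "smooth_convex L F D"
  shows "0 \<le> (D y - D x) \<bullet> (y - x)" "(D y - D x) \<bullet> (y - x) \<le> L * (norm (y - x))\<^sup>2"
  using smooth_convexD(1)[OF F, of x y] smooth_convexD(2)[OF F, of y x] smooth_convexD(1)[OF F, of y x] smooth_convexD(2)[OF F, of x y]
  by (simp_all add: inner_diff_left inner_diff_right norm_minus_commute)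

text \<open>Both mixed second differences of \<open>F\<close> at \<open>x\<close> equal the same symmetric difference
  \<open>F (x + sa + sb) - F (x + sa) - F (x + sb) + F x\<close>; the mean value theorem evaluates it
  as \<open>s\<^sup>2 (J a) \<bullet> b + o(s\<^sup>2)\<close>.\<close>

lemma second_difference_tendsto:
  fixes F :: "'a::real_inner \<Rightarrow> real"
  assumes grad: "\<And>z. GDERIV F z :> D z" and J: "(D has_derivative J) (at x)"
  shows "((\<lambda>s. (F (x + s *\<^sub>R a + s *\<^sub>R b) - (F (x + s *\<^sub>R b) + F (x + s *\<^sub>R a)) + F x) / s\<^sup>2)
           \<longlongrightarrow> J a \<bullet> b) (at_right 0)"
proof (rule tendstoI)
  fix e :: real assume e: "e > 0"
  \<comment> \<open>Two remainders of size at most c s P, with P =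
    \<open>norm a + norm b + 1\<close>, will be paired with \<open>b\<close>; this choice makes the
    total less than \<open>e * s\<close>. The added ones keep the denominators positive for zero
    vectors.\<close>
  define c where "c = e / (2 * (norm a + norm b + 1) * (norm b + 1))"
  have c: "c > 0" using e unfolding c_def by (intro divide_pos_pos mult_pos_pos add_nonneg_pos) auto
  have lin: "linear J" using J has_derivative_linear by blast
  obtain \<delta> where \<delta>: "\<delta> > 0" "\<And>h. norm h < \<delta> \<Longrightarrow> norm (D (x + h) - D x - J h) \<le> c * norm h"
  proof -
    obtain \<delta> where "\<delta> > 0" "\<forall>y. norm (y - x) < \<delta> \<longrightarrow> norm (D y - D x - J (y - x)) \<le> c * norm (y - x)"
      using J c unfolding has_derivative_at_alt by blast
    then show thesis using that[of \<delta>] by (metis add_diff_cancel_left')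
  qed
  have "\<forall>\<^sub>F s in at_right 0. (0::real) < s \<and> s < \<delta> / (norm a + norm b + 1)"
    by (intro eventually_conj eventually_at_right_less)
      (use \<delta>(1) in \<open>auto simp: eventually_at_right_field intro!: exI[of _ "\<delta> / (norm a + norm b + 1)"] divide_pos_pos add_nonneg_pos\<close>)
  then show "\<forall>\<^sub>F s in at_right 0. dist ((F (x + s *\<^sub>R a + s *\<^sub>R b) 
      - (F (x + s *\<^sub>R b) + F (x + s *\<^sub>R a)) + F x) / s\<^sup>2) (J a \<bullet> b) < e"
  proof eventually_elim
    case (elim s)
    then have s: "s > 0" and s\<delta>: "s * (norm a + norm b + 1) < \<delta>"
      by (auto simp: pos_less_divide_eq add_nonneg_pos)
    \<comment> \<open>The difference in direction \<open>a\<close> is kept whole and the mean value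
      theorem runs only along \<open>b\<close>. This leaves \<open>D\<close> at two points within s
      P of \<open>x\<close>, where its linearization at \<open>x\<close> applies.\<close>
    define \<phi> where "\<phi> t = F (x + s *\<^sub>R a + t *\<^sub>R b) - F (x + t *\<^sub>R b)" for t
    have der: "DERIV \<phi> t :> (D (x + s *\<^sub>R a + t *\<^sub>R b) - D (x + t *\<^sub>R b)) \<bullet> b" for t
    proof -
      have "((\<lambda>t. F (z + t *\<^sub>R b)) has_derivative (\<lambda>h. (h *\<^sub>R b) \<bullet> D (z + t *\<^sub>R b))) (at t)" for z
      proof -
        have "((\<lambda>t. z + t *\<^sub>R b) has_derivative (\<lambda>h. h *\<^sub>R b)) (at t)"
          by (auto intro!: derivative_eq_intros)
        from has_derivative_compose[OF this grad[unfolded gderiv_def]] show ?thesis by simp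
      qed
      from has_derivative_diff[OF this[of "x + s *\<^sub>R a"] this[of x]]
      show ?thesis unfolding \<phi>_def has_field_derivative_def
        by (rule has_derivative_eq_rhs) (auto simp: inner_simps fun_eq_iff inner_commute algebra_simps)
    qed
    obtain \<xi> where \<xi>: "0 < \<xi>" "\<xi> < s"
      "\<phi> s - \<phi> 0 = (s - 0) * ((D (x + s *\<^sub>R a + \<xi> *\<^sub>R b) - D (x + \<xi> *\<^sub>R b)) \<bullet> b)"
      using MVT2[OF s der] by blast
    define h1 h2 where "h1 = s *\<^sub>R a + \<xi> *\<^sub>R b" and "h2 = \<xi> *\<^sub>R b"
    have h1: "norm h1 \<le> s * (norm a + norm b + 1)"
    proof -
      have "norm h1 \<le> s * norm a + \<xi> * norm b"
        unfolding h1_def using norm_triangle_ineq[of "s *\<^sub>R a" "\<xi> *\<^sub>R b"] s \<xi> by simp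
      also have "\<dots> \<le> s * norm a + s * norm b + s"
        using \<xi> s mult_right_mono[of \<xi> s "norm b"] by simp
      finally show ?thesis by (simp add: algebra_simps)
    qed
    have h2: "norm h2 \<le> s * (norm a + norm b + 1)"
    proof -
      have "norm h2 \<le> s * norm b" unfolding h2_def using \<xi> by (simp add: mult_right_mono)
      also have "\<dots> \<le> s * (norm a + norm b + 1)" using s by (intro mult_left_mono) auto
      finally show ?thesis .
    qed
    define R where "R h = D (x + h) - D x - J h" for h
    have R: "norm (R h) \<le> c * (s * (norm a + norm b + 1))" if "norm h \<le> s * (norm a + norm b + 1)" for h
      using \<delta>(2)[of h] that s\<delta> mult_left_mono[OF that, of c] c unfolding R_def by linarith
    have diff: "D (x + s *\<^sub>R a + \<xi> *\<^sub>R b) - D (x + \<xi> *\<^sub>R b) = s *\<^sub>R J a + (R h1 - R h2)"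
      unfolding R_def h1_def h2_def by (simp add: linear_add[OF lin] linear_cmul[OF lin] add.assoc)
    have "\<phi> s - \<phi> 0 - s\<^sup>2 * (J a \<bullet> b) = s * ((R h1 - R h2) \<bullet> b)"
      using \<xi>(3) unfolding diff by (simp add: inner_add_left distrib_left power2_eq_square)
    then have "(\<phi> s - \<phi> 0 - s\<^sup>2 * (J a \<bullet> b)) / s\<^sup>2 = ((R h1 - R h2) \<bullet> b) / s"
      using s by (simp add: power2_eq_square)
    then have "(\<phi> s - \<phi> 0) / s\<^sup>2 - J a \<bullet> b = ((R h1 - R h2) \<bullet> b) / s"
      using s by (simp add: diff_divide_distrib)
    moreover have "\<bar>(R h1 - R h2) \<bullet> b\<bar> < e * s"
    proof -
      have "\<bar>(R h1 - R h2) \<bullet> b\<bar> \<le> norm (R h1 - R h2) * norm b" by (rule Cauchy_Schwarz_ineq2)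
      also have "\<dots> \<le> (2 * (c * (s * (norm a + norm b + 1)))) * norm b"
        using norm_triangle_ineq4[of "R h1" "R h2"] R[OF h1] R[OF h2] by (intro mult_right_mono) auto
      also have "\<dots> < (2 * (c * (s * (norm a + norm b + 1)))) * (norm b + 1)"
        using c s by (intro mult_strict_left_mono mult_pos_pos) (auto intro: add_nonneg_pos)
      also have "\<dots> = e * s"
      proof -
        have "2 * (e / (2 * P * Q) * (s * P)) * Q = e * s" if "P \<noteq> 0" "Q \<noteq> 0" for P Q :: real
          using that by simp
        moreover have "norm a + norm b + 1 \<noteq> 0" "norm b + 1 \<noteq> 0"
          using norm_ge_zero[of a] norm_ge_zero[of b] by linarith+
        ultimately show ?thesis unfolding c_def by blast
      qed
      finally show ?thesis .
    qed
    then have "\<bar>((R h1 - R h2) \<bullet> b) / s\<bar> < e"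
      unfolding abs_divide using s by (simp add: pos_divide_less_eq)
    ultimately have "\<bar>(\<phi> s - \<phi> 0) / s\<^sup>2 - J a \<bullet> b\<bar> < e"
      by (simp only:)
    moreover have "F (x + s *\<^sub>R a + s *\<^sub>R b) - (F (x + s *\<^sub>R b) + F (x + s *\<^sub>R a)) + F x = \<phi> s - \<phi> 0"
      by (simp add: \<phi>_def)
    ultimately show ?case by (simp only: dist_real_def)
  qed
qed

text \<open>Schwarz's theorem with \<open>D\<close> differentiable at the single point
  \<open>x\<close>: the second difference does not change when \<open>a\<close> and \<open>b\<close>
  are swapped. The gradient of a Moreau envelope need not be continuously differentiable, so the
  Jacobians in \<open>clarke_jacobian\<close> call for this pointwise form.\<close>

lemma derivative_of_gradient_symmetric:
  fixes F :: "'a::real_inner \<Rightarrow> real"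
  assumes "\<And>z. GDERIV F z :> D z" "(D has_derivative J) (at x)"
  shows "J a \<bullet> b = J b \<bullet> a"
proof (rule tendsto_unique[OF trivial_limit_at_right_real[of 0] second_difference_tendsto[OF assms]])
  show "((\<lambda>s. (F (x + s *\<^sub>R a + s *\<^sub>R b) - (F (x + s *\<^sub>R b) + F (x + s *\<^sub>R a)) + F x) / s\<^sup>2)
           \<longlongrightarrow> J b \<bullet> a) (at_right 0)"
    using second_difference_tendsto[OF assms, of b a] by (simp only: add_ac)
qed

lemma smooth_convex_derivative_bounds:
  assumes F: "smooth_convex L F D" and J: "(D has_derivative J) (at x)"
  shows "0 \<le> J v \<bullet> v" "J v \<bullet> v \<le> L * (norm v)\<^sup>2"
proof -
  have "((\<lambda>s. x + s *\<^sub>R v) has_derivative (\<lambda>h. h *\<^sub>R v)) (at 0)"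
    by (auto intro!: derivative_eq_intros)
  then have "((\<lambda>s. D (x + s *\<^sub>R v)) has_derivative (\<lambda>h. J (h *\<^sub>R v))) (at 0)"
    by (rule has_derivative_compose) (use J in simp)
  then have "((\<lambda>s. D (x + s *\<^sub>R v) \<bullet> v) has_derivative (\<lambda>h. J (h *\<^sub>R v) \<bullet> v)) (at 0)"
    by (rule has_derivative_inner_left)
  then have "DERIV (\<lambda>s. D (x + s *\<^sub>R v) \<bullet> v) 0 :> J v \<bullet> v"
    unfolding has_field_derivative_def
    by (rule has_derivative_eq_rhs)
      (simp add: fun_eq_iff linear_cmul[OF has_derivative_linear[OF J]] mult.commute)
  then have lim: "((\<lambda>s. ((D (x + s *\<^sub>R v) - D x) \<bullet> v) / s) \<longlongrightarrow> J v \<bullet> v) (at_right 0)"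
    unfolding DERIV_def by (simp add: inner_diff_left filterlim_at_split)
  have quot: "((D (x + s *\<^sub>R v) - D x) \<bullet> v) / s = ((D (x + s *\<^sub>R v) - D x) \<bullet> (s *\<^sub>R v)) / s\<^sup>2"
    if "s > 0" for s :: real
    using that by (simp add: power2_eq_square)
  show "0 \<le> J v \<bullet> v"
  proof (rule tendsto_lowerbound[OF lim _ trivial_limit_at_right_real])
    show "\<forall>\<^sub>F s in at_right 0. 0 \<le> ((D (x + s *\<^sub>R v) - D x) \<bullet> v) / s"
      using eventually_at_right_less[of 0]
    proof eventually_elim
      case (elim s)
      show ?case
        using smooth_convex_inner_diff(1)[OF F, of "x + s *\<^sub>R v" x] quot[OF elim] by simp
    qed
  qed
  show "J v \<bullet> v \<le> L * (norm v)\<^sup>2"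
  proof (rule tendsto_upperbound[OF lim _ trivial_limit_at_right_real])
    show "\<forall>\<^sub>F s in at_right 0. ((D (x + s *\<^sub>R v) - D x) \<bullet> v) / s \<le> L * (norm v)\<^sup>2"
      using eventually_at_right_less[of 0]
    proof eventually_elim
      case (elim s)
      have "(D (x + s *\<^sub>R v) - D x) \<bullet> (s *\<^sub>R v) \<le> L * (s\<^sup>2 * (norm v)\<^sup>2)"
        using smooth_convex_inner_diff(2)[OF F, of "x + s *\<^sub>R v" x] by (simp add: power_mult_distrib)
      then show ?case unfolding quot[OF elim] using elim by (simp add: pos_divide_le_eq mult_ac)
    qed
  qed
qed

subsection \<open>Generalized Hessians\<close>

text \<open>Quadratic forms replace eigenvalues and operator norms: for fixed vectors each clause is
  a linear condition on \<open>V\<close>, so it survives limits and convex combinations.\<close>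

definition psd_bounded :: "real \<Rightarrow> real^'n^'n \<Rightarrow> bool" where
  "psd_bounded L V \<longleftrightarrow> (\<forall>v w. v \<bullet> (V *v w) = w \<bullet> (V *v v)) \<and>
     (\<forall>v. 0 \<le> v \<bullet> (V *v v) \<and> v \<bullet> (V *v v) \<le> L * (norm v)\<^sup>2)"

lemma psd_boundedD:
  assumes "psd_bounded L V"
  shows "v \<bullet> (V *v w) = w \<bullet> (V *v v)" "0 \<le> v \<bullet> (V *v v)" "v \<bullet> (V *v v) \<le> L * (norm v)\<^sup>2"
  using assms unfolding psd_bounded_def by blast+

lemma psd_bounded_add:
  assumes "psd_bounded K U" "psd_bounded L V"
  shows "psd_bounded (K + L) (U + V)"
  unfolding psd_bounded_def matrix_vector_mult_add_rdistrib inner_add_right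
proof (intro conjI allI)
  fix v w
  show "v \<bullet> (U *v w) + v \<bullet> (V *v w) = w \<bullet> (U *v v) + w \<bullet> (V *v v)"
    using psd_boundedD(1)[OF assms(1), of v w] psd_boundedD(1)[OF assms(2), of v w] by simp
  show "0 \<le> v \<bullet> (U *v v) + v \<bullet> (V *v v)"
    using psd_boundedD(2)[OF assms(1), of v] psd_boundedD(2)[OF assms(2), of v] by simp
  show "v \<bullet> (U *v v) + v \<bullet> (V *v v) \<le> (K + L) * (norm v)\<^sup>2"
    using psd_boundedD(3)[OF assms(1), of v] psd_boundedD(3)[OF assms(2), of v]
    by (simp add: distrib_right)
qed

lemma psd_bounded_scaleR:
  assumes "psd_bounded L V" "c \<ge> 0"
  shows "psd_bounded (c * L) (c *\<^sub>R V)"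
  using psd_boundedD[OF assms(1)] assms(2)
  by (auto simp: psd_bounded_def scaleR_matrix_vector_assoc[symmetric] mult.assoc intro: mult_left_mono)

lemma inner_congruence_matrix:
  fixes A :: "real^'n^'m" and V :: "real^'m^'m"
  shows "v \<bullet> ((transpose A ** V ** A) *v w) = (A *v v) \<bullet> (V *v (A *v w))"
  by (metis dot_lmul_matrix matrix_mul_assoc matrix_vector_mul_assoc transpose_transpose
      vector_transpose_matrix)

lemma psd_bounded_congruence:
  fixes A :: "real^'n^'m" and V :: "real^'m^'m"
  assumes V: "psd_bounded L V" and K: "\<And>x. norm (A *v x) \<le> K * norm x" and L: "L \<ge> 0"
  shows "psd_bounded (L * K\<^sup>2) (transpose A ** V ** A)"
  unfolding psd_bounded_def inner_congruence_matrix
proof (intro conjI allI)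
  fix v w
  show "(A *v v) \<bullet> (V *v (A *v w)) = (A *v w) \<bullet> (V *v (A *v v))"
    "0 \<le> (A *v v) \<bullet> (V *v (A *v v))"
    by (fact psd_boundedD[OF V])+
  have "(norm (A *v v))\<^sup>2 \<le> K\<^sup>2 * (norm v)\<^sup>2"
    using power_mono[OF K[of v], of 2] by (simp add: power_mult_distrib)
  then have "L * (norm (A *v v))\<^sup>2 \<le> L * K\<^sup>2 * (norm v)\<^sup>2"
    using mult_left_mono[of _ _ L] L by (fastforce simp: mult.assoc)
  then show "(A *v v) \<bullet> (V *v (A *v v)) \<le> L * K\<^sup>2 * (norm v)\<^sup>2"
    using psd_boundedD(3)[OF V, of "A *v v"] by linarith
qed

lemma psd_bounded_gram:
  fixes A :: "real^'n^'m"
  assumes K: "\<And>x. norm (A *v x) \<le> K * norm x"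
  shows "psd_bounded (K\<^sup>2) (transpose A ** A)"
proof -
  have "psd_bounded 1 (mat 1 :: real^'m^'m)"
    by (simp add: psd_bounded_def dot_square_norm inner_commute)
  from psd_bounded_congruence[OF this K] show ?thesis by simp
qed

lemma convex_psd_bounded: "convex {V. psd_bounded L V}"
proof (rule convexI)
  fix U V :: "real^'n^'n" and a b :: real
  assume "U \<in> {V. psd_bounded L V}" "V \<in> {V. psd_bounded L V}" "0 \<le> a" "0 \<le> b" "a + b = 1"
  then have "psd_bounded (a * L + b * L) (a *\<^sub>R U + b *\<^sub>R V)"
    by (intro psd_bounded_add psd_bounded_scaleR) auto
  then show "a *\<^sub>R U + b *\<^sub>R V \<in> {V. psd_bounded L V}"
    using \<open>a + b = 1\<close> by (simp add: distrib_right[symmetric])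
qed

lemma tendsto_inner_matrix_vector:
  fixes V :: "nat \<Rightarrow> real^'n^'m"
  assumes "V \<longlonglongrightarrow> W"
  shows "(\<lambda>i. v \<bullet> (V i *v w)) \<longlonglongrightarrow> v \<bullet> (W *v w)"
proof -
  have "linear (\<lambda>M :: real^'n^'m. v \<bullet> (M *v w))"
    by (intro linearI) (simp_all add: matrix_vector_mult_add_rdistrib inner_add_right
        scaleR_matrix_vector_assoc[symmetric])
  then have "continuous (at W) (\<lambda>M :: real^'n^'m. v \<bullet> (M *v w))"
    using linear_continuous_at linear_conv_bounded_linear by blast
  then show ?thesis using assms by (rule isCont_tendsto_compose)
qed

text \<open>Where \<open>D\<close> is differentiable, symmetry comes from second differences and the
  bounds from the inequalities for increments of \<open>D\<close>. Limits keep all clauses, and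
  convexity of the class carries them to the hull.\<close>

lemma clarke_jacobian_gradient_psd_bounded:
  fixes D :: "real^'n \<Rightarrow> real^'n"
  assumes F: "smooth_convex L F D" and V: "V \<in> clarke_jacobian D x"
  shows "psd_bounded L V"
proof -
  have jac: "psd_bounded L (jacobian D (at z))" if "D differentiable at z" for z
  proof -
    have der: "(D has_derivative (\<lambda>h. jacobian D (at z) *v h)) (at z)"
      using that jacobian_works by blast
    show ?thesis
      unfolding psd_bounded_def
      using derivative_of_gradient_symmetric[OF smooth_convex_gderiv[OF F] der]
        smooth_convex_derivative_bounds[OF F der]
      by (simp add: inner_commute)
  qed
  have "{V. \<exists>xs. xs \<longlonglongrightarrow> x \<and> (\<forall>i. D differentiable at (xs i)) \<and>
              (\<lambda>i. jacobian D (at (xs i))) \<longlonglongrightarrow> V} \<subseteq> {V. psd_bounded L V}"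
  proof clarify
    fix W xs
    assume diff: "\<forall>i. D differentiable at (xs i)" and lim: "(\<lambda>i. jacobian D (at (xs i))) \<longlonglongrightarrow> W"
    note J = psd_boundedD[OF jac[OF diff[rule_format]]]
    show "psd_bounded L W"
      unfolding psd_bounded_def
    proof (intro conjI allI)
      fix v w
      show "v \<bullet> (W *v w) = w \<bullet> (W *v v)"
        using tendsto_inner_matrix_vector[OF lim, of v w] tendsto_inner_matrix_vector[OF lim, of w v]
        unfolding J(1)[of v _ w] by (rule LIMSEQ_unique)
      show "0 \<le> v \<bullet> (W *v v)"
        by (rule LIMSEQ_le_const[OF tendsto_inner_matrix_vector[OF lim]]) (use J(2) in blast)
      show "v \<bullet> (W *v v) \<le> L * (norm v)\<^sup>2"
        by (rule LIMSEQ_le_const2[OF tendsto_inner_matrix_vector[OF lim]]) (use J(3) in blast)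
    qed
  qed
  then show ?thesis
    using V hull_minimal[where S = convex, OF _ convex_psd_bounded] unfolding clarke_jacobian_def by blast
qed

subsection \<open>Conjugate gradients and Armijo line search\<close>

text \<open>Exact minimization along \<open>s'\<close> makes the new residual orthogonal to
  \<open>s'\<close>, so adding a multiple of \<open>s'\<close> to \<open>r\<close> leaves the
  product with \<open>r\<close> unchanged. The relation says that the quotient with numerator
  \<open>r \<bullet> r\<close> is the exact minimizing step along \<open>s\<close>. For
  \<open>s' = 0\<close> the orthogonality is trivial.\<close>

lemma cg_state_invariant:
  fixes V :: "real^'n^'n"
  assumes pos: "\<And>x. x \<noteq> 0 \<Longrightarrow> 0 < x \<bullet> (V *v x)" and "cg_state V b i = (d, r, s)"
  shows "r = b - V *v d" "s \<bullet> r = r \<bullet> r"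
proof -
  have "r = b - V *v d \<and> s \<bullet> r = r \<bullet> r"
    using assms(2)
  proof (induction i arbitrary: d r s)
    case (Suc i)
    obtain d' r' s' where st: "cg_state V b i = (d', r', s')" by (cases "cg_state V b i")
    have IH: "r' = b - V *v d'" "s' \<bullet> r' = r' \<bullet> r'" using Suc.IH[OF st] by auto
    define a where "a = (r' \<bullet> r') / (s' \<bullet> (V *v s'))"
    have d: "d = d' + a *\<^sub>R s'" and r: "r = r' - a *\<^sub>R (V *v s')"
      and s: "s = r + ((r \<bullet> r) / (r' \<bullet> r')) *\<^sub>R s'"
      using Suc.prems by (auto simp: st Let_def a_def)
    have "s' \<bullet> r = 0"
    proof (cases "s' = 0")
      case False
      then show ?thesis using pos[of s'] IH(2) by (simp add: r a_def inner_diff_right)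
    qed simp
    then have "s \<bullet> r = r \<bullet> r" by (simp add: s inner_add_left)
    moreover have "r = b - V *v d"
      by (simp add: r d IH(1) matrix_vector_mult_scaleR matrix_vector_right_distrib)
    ultimately show ?case by simp
  qed simp
  then show "r = b - V *v d" "s \<bullet> r = r \<bullet> r" by auto
qed

text \<open>Each step minimizes the energy exactly along its search direction. That the energy never
  increases is a weak property of the conjugate gradient method, but it needs neither conjugacy
  of the directions nor orthogonality of the residuals, and the first step alone (steepest
  descent) gives the lower bound on \<open>b \<bullet> d\<close>.\<close>

lemma cg_iterate_energy:
  fixes V :: "real^'n^'n" and b :: "real^'n"
  assumes sym: "\<And>v w. v \<bullet> (V *v w) = w \<bullet> (V *v v)"
    and pos: "\<And>x. x \<noteq> 0 \<Longrightarrow> 0 < x \<bullet> (V *v x)" and "i \<ge> 1"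
  defines "d \<equiv> cg_iterate V b i"
  shows "(d \<bullet> (V *v d)) / 2 + (b \<bullet> b)\<^sup>2 / (2 * (b \<bullet> (V *v b))) \<le> b \<bullet> d"
proof -
  \<comment> \<open>The gradient \<open>V x - b\<close> of this energy is minus the residual, so the
    linear term of a step along \<open>s\<close> is governed by
    \<open>s \<bullet> r\<close>.\<close>
  define q where "q x = (x \<bullet> (V *v x)) / 2 - b \<bullet> x" for x
  have step: "q (cg_iterate V b (Suc k)) =
      q (fst (cg_state V b k)) - (r \<bullet> r)\<^sup>2 / (2 * (s \<bullet> (V *v s)))"
    if st: "cg_state V b k = (x, r, s)" for k x r s
  proof -
    note inv = cg_state_invariant[OF pos st]
    have sr: "s \<bullet> r = r \<bullet> r" by (rule inv(2))
    define \<kappa> where "\<kappa> = s \<bullet> (V *v s)"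
    define a where "a = (r \<bullet> r) / \<kappa>"
    have "cg_iterate V b (Suc k) = x + a *\<^sub>R s"
      by (simp add: cg_iterate_def st Let_def a_def \<kappa>_def)
    moreover have "q (x + a *\<^sub>R s) = q x - a * (s \<bullet> r) + a\<^sup>2 / 2 * \<kappa>"
      using sym[of x s]
      by (simp add: q_def inv(1) \<kappa>_def matrix_vector_right_distrib matrix_vector_mult_scaleR
          inner_add_left inner_add_right inner_diff_right inner_commute[of b]
          distrib_left right_diff_distrib add_divide_distrib power2_eq_square)
    \<comment> \<open>For \<open>\<kappa> = 0\<close> the quotients are 0 by convention and both
      sides vanish, which covers a run that has already terminated.\<close>
    moreover have "a * (s \<bullet> r) - a\<^sup>2 / 2 * \<kappa> = (r \<bullet> r)\<^sup>2 / (2 * \<kappa>)"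
      by (cases "\<kappa> = 0") (simp_all add: sr a_def power2_eq_square)
    ultimately show ?thesis by (simp add: st \<kappa>_def)
  qed
  have nonneg: "0 \<le> x \<bullet> (V *v x)" for x
    using pos[of x] by (cases "x = 0") auto
  have "q (cg_iterate V b i) \<le> - ((b \<bullet> b)\<^sup>2 / (2 * (b \<bullet> (V *v b))))"
    using \<open>i \<ge> 1\<close>
  proof (induction i rule: dec_induct)
    case base
    \<comment> \<open>Starting from 0 with residual and direction \<open>b\<close>, the first step
      alone supplies the whole subtracted term.\<close>
    show ?case using step[of 0] by (simp add: q_def)
  next
    case (step k)
    obtain x r s where st: "cg_state V b k = (x, r, s)" by (cases "cg_state V b k")
    have "(r \<bullet> r)\<^sup>2 / (2 * (s \<bullet> (V *v s))) \<ge> 0" using nonneg[of s] by simp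
    then show ?case using \<open>\<And>s r k x. cg_state V b k = (x, r, s) \<Longrightarrow> _\<close>[OF st] step.IH
      unfolding cg_iterate_def[of _ _ k] by linarith
  qed
  then show ?thesis by (simp add: q_def d_def)
qed

lemma cg_iterate_0_right [simp]: "cg_iterate V 0 i = 0"
proof -
  have "cg_state V 0 i = (0, 0, 0)"
    by (induction i) (simp_all add: Let_def)
  then show ?thesis by (simp add: cg_iterate_def)
qed

text \<open>In the energy estimate with b = -G, bounding \<open>V\<close> above by L + \<theta> in
  the second term gives the descent. Bounding \<open>V\<close> below by \<theta> in the first gives
  \<theta> |d|^2 / 2 <= |G| |d|; as \<theta> is proportional to |G|, the gradient cancels and a
  uniform bound on \<open>d\<close> remains.\<close>

lemma newton_direction_descent:
  assumes H: "psd_bounded L H" and L: "L > 0" and \<tau>1: "\<tau>1 > 0" and G: "G \<noteq> 0"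
    and d: "newton_direction H G \<tau> \<tau>1 \<tau>2 d"
  shows "(norm G)\<^sup>2 / (2 * (L + \<tau>1 * norm G)) \<le> - (G \<bullet> d)" "norm d \<le> 2 / \<tau>1"
proof -
  define \<theta> where "\<theta> = \<tau>1 * norm G"
  define V where "V = H + \<theta> *\<^sub>R mat 1"
  have \<theta>: "\<theta> > 0" using \<tau>1 G by (simp add: \<theta>_def)
  have V: "v \<bullet> (V *v w) = v \<bullet> (H *v w) + \<theta> * (v \<bullet> w)" for v w
    by (simp add: V_def matrix_vector_mult_add_rdistrib inner_add_right
        scaleR_matrix_vector_assoc[symmetric])
  obtain i where i: "i \<ge> 1" "d = cg_iterate V (- G) i"
    using d unfolding newton_direction_def Let_def V_def \<theta>_def by blast
  have sym: "v \<bullet> (V *v w) = w \<bullet> (V *v v)" for v w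
    using psd_boundedD(1)[OF H, of v w] by (simp add: V inner_commute)
  have pos: "0 < v \<bullet> (V *v v)" if "v \<noteq> 0" for v
    using psd_boundedD(2)[OF H, of v] \<theta> that by (simp add: V add_nonneg_pos)
  have en: "(d \<bullet> (V *v d)) / 2 + (G \<bullet> G)\<^sup>2 / (2 * (- G \<bullet> (V *v - G))) \<le> - G \<bullet> d"
    using cg_iterate_energy[OF sym pos i(1), of "- G"] unfolding i(2) by simp
  have VG: "0 < - G \<bullet> (V *v - G)" "- G \<bullet> (V *v - G) \<le> (L + \<theta>) * (norm G)\<^sup>2"
    using pos[of "- G"] G psd_boundedD(3)[OF H, of "- G"]
    by (simp_all add: V distrib_right dot_square_norm)
  have "(norm G)\<^sup>2 / (2 * (L + \<theta>)) = (G \<bullet> G)\<^sup>2 / (2 * ((L + \<theta>) * (norm G)\<^sup>2))"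
    using G by (simp add: dot_square_norm power2_eq_square)
  also have "\<dots> \<le> (G \<bullet> G)\<^sup>2 / (2 * (- G \<bullet> (V *v - G)))"
    using VG G L \<theta> by (intro divide_left_mono mult_pos_pos) auto
  also have "\<dots> \<le> - G \<bullet> d"
    using en pos[of d] by (cases "d = 0") auto
  finally show "(norm G)\<^sup>2 / (2 * (L + \<tau>1 * norm G)) \<le> - (G \<bullet> d)"
    by (simp add: \<theta>_def)
  show "norm d \<le> 2 / \<tau>1"
  proof (cases "d = 0")
    case False
    have "\<theta> * (norm d)\<^sup>2 / 2 \<le> (d \<bullet> (V *v d)) / 2"
      using psd_boundedD(2)[OF H, of d] by (simp add: V dot_square_norm)
    also have "\<dots> \<le> - G \<bullet> d"
    proof -
      have "0 \<le> (G \<bullet> G)\<^sup>2 / (2 * (- G \<bullet> (V *v - G)))"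
        using VG(1) by (intro divide_nonneg_pos) auto
      then show ?thesis using en by linarith
    qed
    also have "\<dots> \<le> norm G * norm d"
      using norm_cauchy_schwarz[of "- G" d] by simp
    finally have "norm G * norm d * (\<tau>1 * norm d) \<le> norm G * norm d * 2"
      by (simp add: \<theta>_def power2_eq_square mult_ac)
    then have "\<tau>1 * norm d \<le> 2"
      by (rule mult_left_le_imp_le) (use G False in simp)
    then show ?thesis using \<tau>1 by (simp add: pos_le_divide_eq mult.commute)
  qed (use \<tau>1 in simp)
qed

text \<open>At a stationary point the regularization vanishes and the system may be singular, but
  with right-hand side 0 conjugate gradients never leave 0, so the iterate stays put.\<close>

lemma newton_direction_0:
  assumes "newton_direction H 0 \<tau> \<tau>1 \<tau>2 d"
  shows "d = 0"
  using assms by (auto simp: newton_direction_def Let_def)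

text \<open>By the quadratic majorant, every step t <= s / (L |d|^2) lowers \<open>F\<close> by at
  least t s / 2, which passes the test since \<zeta> < 1/2. Hence backtracking stops, at most one
  factor \<beta> below that threshold.\<close>

lemma armijo_step_decrease:
  assumes F: "smooth_convex L F D" and L: "L > 0"
    and params: "0 < \<beta>" "\<beta> < 1" "0 < \<zeta>" "\<zeta> < 1/2"
    and s: "s = - (D x \<bullet> d)" "s > 0"
  defines "\<alpha> \<equiv> armijo_step F \<beta> \<zeta> x d"
  shows "F (x + \<alpha> *\<^sub>R d) \<le> F x - \<zeta> * \<alpha> * s" "\<alpha> \<ge> min 1 (\<beta> * s / (L * (norm d)\<^sup>2))"
proof -
  define P where "P q \<longleftrightarrow> F (x + \<beta> ^ q *\<^sub>R d) \<le> F x + \<zeta> * \<beta> ^ q * (D x \<bullet> d)" for q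
  define \<kappa> where "\<kappa> = L * (norm d)\<^sup>2"
  have "d \<noteq> 0" using s by auto
  then have \<kappa>: "\<kappa> > 0" using L by (simp add: \<kappa>_def)
  have P: "P q" if "\<beta> ^ q \<le> s / \<kappa>" for q
  proof -
    define t where "t = \<beta> ^ q"
    have t: "t > 0" "t * \<kappa> \<le> s"
      using that params \<kappa> by (simp_all add: t_def pos_le_divide_eq)
    have "F (x + t *\<^sub>R d) \<le> F x - t * s + t * (t * \<kappa>) / 2"
      using smooth_convexD(2)[OF F, of "x + t *\<^sub>R d" x] t
      by (simp add: s \<kappa>_def power_mult_distrib power2_eq_square mult_ac)
    also have "\<dots> \<le> F x - t * s + t * s / 2"
      using mult_left_mono[OF t(2), of t] t(1) by linarith
    also have "\<dots> \<le> F x - \<zeta> * (t * s)"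
      using params t s mult_right_mono[of \<zeta> "1/2" "t * s"] by simp
    finally show "P q" by (simp add: P_def t_def s mult_ac)
  qed
  obtain q where "\<beta> ^ q < s / \<kappa>"
    using real_arch_pow_inv[OF divide_pos_pos[OF s(2) \<kappa>] params(2)] by blast
  then have "P q" using P by simp
  have \<alpha>: "\<alpha> = \<beta> ^ (LEAST q. P q)"
    unfolding \<alpha>_def armijo_step_def P_def grad_smooth_convex[OF F] ..
  have "P (LEAST q. P q)" using \<open>P q\<close> by (rule LeastI)
  then show "F (x + \<alpha> *\<^sub>R d) \<le> F x - \<zeta> * \<alpha> * s"
    unfolding P_def \<alpha> by (simp add: s)
  show "\<alpha> \<ge> min 1 (\<beta> * s / (L * (norm d)\<^sup>2))"
  proof (cases "LEAST q. P q")
    case 0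
    then show ?thesis by (simp add: \<alpha>)
  next
    case (Suc n)
    \<comment> \<open>The trial just before the accepted one was rejected, so its length exceeds
      \<open>s / \<kappa>\<close>.\<close>
    then have "\<not> P n" using not_less_Least[of n P] by simp
    then have "s / \<kappa> \<le> \<beta> ^ n" using P[of n] by linarith
    then have "\<beta> * (s / \<kappa>) \<le> \<alpha>"
      unfolding \<alpha> Suc power_Suc using params by (intro mult_left_mono) auto
    then show ?thesis by (simp add: \<kappa>_def min.coboundedI2)
  qed
qed

text \<open>The drops of a decreasing sequence bounded below tend to zero, whereas every index with
  \<open>n j \<ge> e\<close> forces a drop of at least \<open>\<phi> e\<close>.\<close>

lemma decreasing_imp_modulus_tendsto_0:
  fixes F n :: "nat \<Rightarrow> real"
  assumes step: "\<And>j. F (Suc j) \<le> F j - \<phi> (n j)" and bdd: "\<And>j. m \<le> F j"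
    and mono: "\<And>s t. 0 \<le> s \<Longrightarrow> s \<le> t \<Longrightarrow> \<phi> s \<le> \<phi> t" and pos: "\<And>s. s > 0 \<Longrightarrow> \<phi> s > 0"
    and n: "\<And>j. n j \<ge> 0" and \<phi>0: "\<phi> 0 \<ge> 0"
  shows "n \<longlonglongrightarrow> 0"
proof -
  have dec: "F (Suc j) \<le> F j" for j
    using step[of j] mono[of 0 "n j"] n[of j] \<phi>0 by linarith
  then have "decseq F" by (simp add: decseq_Suc_iff)
  then obtain l where l: "F \<longlonglongrightarrow> l" using bdd decseq_convergent by blast
  have "(\<lambda>j. F j - F (Suc j)) \<longlonglongrightarrow> l - l"
    using l by (intro tendsto_diff) (simp_all add: filterlim_sequentially_Suc)
  then have diff: "(\<lambda>j. F j - F (Suc j)) \<longlonglongrightarrow> 0" by simp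
  show ?thesis
  proof (rule tendstoI)
    fix e :: real assume e: "e > 0"
    have "\<forall>\<^sub>F j in sequentially. F j - F (Suc j) < \<phi> e"
      using diff pos[OF e] by (rule order_tendstoD)
    then show "\<forall>\<^sub>F j in sequentially. dist (n j) 0 < e"
    proof eventually_elim
      case (elim j)
      show ?case
      proof (rule ccontr)
        assume "\<not> dist (n j) 0 < e"
        then have "e \<le> n j" using n[of j] by (simp add: dist_real_def)
        then show False using mono[of e "n j"] e step[of j] elim by simp
      qed
    qed
  qed
qed

lemma newton_armijo_convergence:
  fixes x :: "nat \<Rightarrow> real^'n"
  assumes F: "smooth_convex L F D" and L: "L > 0"
    and level: "\<And>c. bounded {x. F x \<le> c}"
    and params: "0 < \<tau>1" "0 < \<beta>" "\<beta> < 1" "0 < \<zeta>" "\<zeta> < 1/2"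
    and step: "\<And>j. \<exists>H d. psd_bounded L H \<and> newton_direction H (D (x j)) \<tau> \<tau>1 \<tau>2 d \<and>
                   x (Suc j) = x j + armijo_step F \<beta> \<zeta> (x j) d *\<^sub>R d"
  shows "bounded (range x)" "(\<lambda>j. D (x j)) \<longlonglongrightarrow> 0"
proof -
  \<comment> \<open>Write \<sigma> for t^2 / (2 (L + \<tau>1 \<Gamma>)), the lower bound on the
    slope s = -<G, d>. The line search gains \<zeta> min(s, \<beta> s^2 / (L |d|^2)), and |d| <= 2 /
    \<tau>1 turns the second entry into \<beta> \<tau>1^2 \<sigma>^2 / (4 L). The bound \<Gamma> on
    the gradient is left as a parameter because it is instantiated twice.\<close>
  define decr where "decr \<Gamma> t =
      \<zeta> * min (t\<^sup>2 / (2 * (L + \<tau>1 * \<Gamma>))) (\<beta> * \<tau>1\<^sup>2 / (4 * L) * (t\<^sup>2 / (2 * (L + \<tau>1 * \<Gamma>)))\<^sup>2)" for \<Gamma> t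
  have decr_nonneg: "decr \<Gamma> t \<ge> 0" if "\<Gamma> \<ge> 0" for \<Gamma> t
    using params L that unfolding decr_def
    by (intro mult_nonneg_nonneg min.boundedI divide_nonneg_pos mult_nonneg_nonneg add_pos_nonneg mult_pos_pos) auto
  have decrease: "F (x (Suc j)) \<le> F (x j) - decr \<Gamma> (norm (D (x j)))"
    if \<Gamma>: "norm (D (x j)) \<le> \<Gamma>" for j \<Gamma>
  proof -
    obtain H d where H: "psd_bounded L H" and d: "newton_direction H (D (x j)) \<tau> \<tau>1 \<tau>2 d"
      and x: "x (Suc j) = x j + armijo_step F \<beta> \<zeta> (x j) d *\<^sub>R d"
      using step[of j] by blast
    show ?thesis
    proof (cases "D (x j) = 0")
      case True
      then show ?thesis using d newton_direction_0[of H \<tau> \<tau>1 \<tau>2 d] by (simp add: x decr_def)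
    next
      case False
      define \<sigma> where "\<sigma> = (norm (D (x j)))\<^sup>2 / (2 * (L + \<tau>1 * \<Gamma>))"
      define s where "s = - (D (x j) \<bullet> d)"
      define \<alpha> where "\<alpha> = armijo_step F \<beta> \<zeta> (x j) d"
      have "\<Gamma> > 0" using \<Gamma> False zero_less_norm_iff order_less_le_trans by blast
      then have \<sigma>: "\<sigma> > 0"
        using False L params by (simp add: \<sigma>_def add_pos_pos)
      have "\<sigma> \<le> (norm (D (x j)))\<^sup>2 / (2 * (L + \<tau>1 * norm (D (x j))))"
        unfolding \<sigma>_def using \<Gamma> False L params \<open>\<Gamma> > 0\<close>
        by (intro divide_left_mono mult_pos_pos add_pos_pos mult_left_mono add_left_mono) auto
      then have s: "\<sigma> \<le> s"
        using newton_direction_descent(1)[OF H L params(1) False d] unfolding s_def by linarith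
      have dn: "norm d \<le> 2 / \<tau>1" by (rule newton_direction_descent(2)[OF H L params(1) False d])
      note armijo = armijo_step_decrease[OF F L params(2-5) s_def, folded \<alpha>_def]
      have "s > 0" using s \<sigma> by linarith
      then have "d \<noteq> 0" by (auto simp: s_def)
      have "\<beta> * \<tau>1\<^sup>2 / (4 * L) * \<sigma>\<^sup>2 \<le> (\<beta> * s / (L * (norm d)\<^sup>2)) * s"
      proof -
        have "(norm d)\<^sup>2 \<le> 4 / \<tau>1\<^sup>2"
          using power_mono[OF dn, of 2] by (simp add: power_divide)
        then have "L * (norm d)\<^sup>2 \<le> L * (4 / \<tau>1\<^sup>2)"
          using L by (intro mult_left_mono) auto
        then have "\<beta> * s\<^sup>2 / (L * (4 / \<tau>1\<^sup>2)) \<le> \<beta> * s\<^sup>2 / (L * (norm d)\<^sup>2)"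
          using params L \<open>d \<noteq> 0\<close> by (intro divide_left_mono mult_pos_pos) auto
        moreover have "\<beta> * \<tau>1\<^sup>2 / (4 * L) * \<sigma>\<^sup>2 \<le> \<beta> * \<tau>1\<^sup>2 / (4 * L) * s\<^sup>2"
          using params L s \<sigma> by (intro mult_left_mono power_mono) auto
        ultimately show ?thesis by (simp add: power2_eq_square mult_ac)
      qed
      then have "min \<sigma> (\<beta> * \<tau>1\<^sup>2 / (4 * L) * \<sigma>\<^sup>2) \<le> min 1 (\<beta> * s / (L * (norm d)\<^sup>2)) * s"
        using s \<open>s > 0\<close> unfolding min_def by auto
      also have "\<dots> \<le> \<alpha> * s"
        using armijo(2)[OF \<open>s > 0\<close>] \<open>s > 0\<close> by (intro mult_right_mono) auto
      finally have "decr \<Gamma> (norm (D (x j))) \<le> \<zeta> * \<alpha> * s"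
        using params by (simp add: decr_def \<sigma>_def)
      then show ?thesis using armijo(1)[OF \<open>s > 0\<close>] by (simp add: x \<alpha>_def)
    qed
  qed
  have "F (x j) \<le> F (x 0)" for j
  proof (induction j)
    case (Suc j)
    \<comment> \<open>\<Gamma> is taken as the gradient norm at the current iterate, since a uniform
      bound becomes available only after boundedness.\<close>
    have "F (x (Suc j)) \<le> F (x j)"
      using decrease[OF order_refl, of j] decr_nonneg[of "norm (D (x j))"] by (smt (verit) norm_ge_zero)
    then show ?case using Suc by linarith
  qed simp
  then have "range x \<subseteq> {z. F z \<le> F (x 0)}" by auto
  then show bdd: "bounded (range x)" using level bounded_subset by blast
  then obtain R where R: "\<And>j. norm (x j) \<le> R" by (auto simp: bounded_iff)
  \<comment> \<open>With all iterates in a ball of radius R, Lipschitz continuity of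
    \<open>D\<close> gives one bound for every gradient, so \<open>decr \<Gamma>\<close> is a fixed
    modulus from here on.\<close>
  define \<Gamma> where "\<Gamma> = norm (D (x 0)) + L * (R + R)"
  have \<Gamma>: "norm (D (x j)) \<le> \<Gamma>" for j
  proof -
    have "norm (D (x j) - D (x 0)) \<le> L * (R + R)"
    proof (rule order_trans[OF smooth_convex_lipschitz[OF F L]])
      show "L * norm (x j - x 0) \<le> L * (R + R)"
        using norm_triangle_ineq4[of "x j" "x 0"] R[of j] R[of 0] L by (intro mult_left_mono) auto
    qed
    then show ?thesis
      using norm_triangle_ineq[of "D (x j) - D (x 0)" "D (x 0)"] by (simp add: \<Gamma>_def)
  qed
  have \<Gamma>0: "\<Gamma> \<ge> 0" using \<Gamma>[of 0] norm_ge_zero order_trans by blast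
  then have den: "2 * (L + \<tau>1 * \<Gamma>) > 0" using L params by (simp add: add_pos_nonneg)
  have "(\<lambda>j. norm (D (x j))) \<longlonglongrightarrow> 0"
  proof (rule decreasing_imp_modulus_tendsto_0)
    show "F (x (Suc j)) \<le> F (x j) - decr \<Gamma> (norm (D (x j)))" for j
      by (rule decrease[OF \<Gamma>])
    show "F (x 0) - norm (D (x 0)) * (R + R) \<le> F (x j)" for j
    proof -
      have "\<bar>D (x 0) \<bullet> (x j - x 0)\<bar> \<le> norm (D (x 0)) * (R + R)"
        using norm_triangle_ineq4[of "x j" "x 0"] R[of j] R[of 0]
        by (intro order_trans[OF Cauchy_Schwarz_ineq2] mult_left_mono) auto
      then show ?thesis using smooth_convexD(1)[OF F, of "x 0" "x j"] by linarith
    qed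
    show "decr \<Gamma> s \<le> decr \<Gamma> t" if "0 \<le> s" "s \<le> t" for s t
      unfolding decr_def using that params L den
      by (intro mult_left_mono min.mono power_mono divide_right_mono) auto
    show "decr \<Gamma> s > 0" if "s > 0" for s
      unfolding decr_def using that params L den by (simp add: zero_less_mult_iff)
  qed (use decr_nonneg[OF \<Gamma>0] in auto)
  then show "(\<lambda>j. D (x j)) \<longlonglongrightarrow> 0" by (rule tendsto_norm_zero_cancel)
qed

subsection \<open>Subgradients, conjugates and Moreau envelopes\<close>

text \<open>Carrying the finite value \<open>c\<close> along keeps the later computations in the
  reals and records that \<open>u\<close> lies in the domain.\<close>

definition has_subgradient :: "('a::real_inner \<Rightarrow> ereal) \<Rightarrow> 'a \<Rightarrow> real \<Rightarrow> 'a \<Rightarrow> bool" where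
  "has_subgradient \<psi> u c v \<longleftrightarrow> \<psi> u = ereal c \<and> (\<forall>x. ereal (c + v \<bullet> (x - u)) \<le> \<psi> x)"

text \<open>Completing the square around \<open>u\<close>: once \<psi> is replaced by its affine
  minorant at \<open>u\<close>, the proximal objective exceeds its value there by exactly a
  square.\<close>

lemma prox_identity:
  fixes u x p :: "'a::real_inner"
  assumes "\<sigma> > 0"
  shows "1 / (2 * \<sigma>) * (norm (x - p))\<^sup>2 + ((p - u) /\<^sub>R \<sigma>) \<bullet> (x - u) =
    1 / (2 * \<sigma>) * (norm (u - p))\<^sup>2 + 1 / (2 * \<sigma>) * (norm (x - u))\<^sup>2"
proof -
  have "(norm (x - p))\<^sup>2 + 2 * ((p - u) \<bullet> (x - u)) = (norm (u - p))\<^sup>2 + (norm (x - u))\<^sup>2"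
    by (simp add: power2_norm_eq_inner inner_diff_left inner_diff_right inner_commute)
  then have "1 / (2 * \<sigma>) * ((norm (x - p))\<^sup>2 + 2 * ((p - u) \<bullet> (x - u))) =
      1 / (2 * \<sigma>) * ((norm (u - p))\<^sup>2 + (norm (x - u))\<^sup>2)" by simp
  then show ?thesis
    using assms by (simp add: distrib_left inverse_eq_divide)
qed

lemma prox_obj_ge:
  assumes \<sigma>: "\<sigma> > 0" and sub: "has_subgradient \<psi> u c ((p - u) /\<^sub>R \<sigma>)"
  shows "ereal (1 / (2 * \<sigma>) * (norm (u - p))\<^sup>2 + c + 1 / (2 * \<sigma>) * (norm (x - u))\<^sup>2) \<le> prox_obj \<sigma> \<psi> p x"
proof -
  have "ereal (c + ((p - u) /\<^sub>R \<sigma>) \<bullet> (x - u)) \<le> \<psi> x"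
    using sub unfolding has_subgradient_def by blast
  from add_left_mono[OF this, of "ereal (1 / (2 * \<sigma>) * (norm (x - p))\<^sup>2)"]
  have "ereal (c + (1 / (2 * \<sigma>) * (norm (x - p))\<^sup>2 + ((p - u) /\<^sub>R \<sigma>) \<bullet> (x - u))) \<le> prox_obj \<sigma> \<psi> p x"
    unfolding prox_obj_def by (simp only: plus_ereal.simps ac_simps)
  then show ?thesis unfolding prox_identity[OF \<sigma>] by (simp only: ac_simps)
qed

text \<open>Quadratic growth around \<open>u\<close> makes the subgradient a certificate that pins
  down both the description operator in \<open>prox\<close> and the infimum in
  \<open>moreau_env\<close>. It applies to any \<psi>, in particular to a conjugate with a known
  subgradient.\<close>

lemma prox_eqI:
  assumes \<sigma>: "\<sigma> > 0" and sub: "has_subgradient \<psi> u c ((p - u) /\<^sub>R \<sigma>)"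
  shows "prox \<sigma> \<psi> p = u" "moreau_env \<sigma> \<psi> p = 1 / (2 * \<sigma>) * (norm (u - p))\<^sup>2 + c"
proof -
  let ?m = "1 / (2 * \<sigma>) * (norm (u - p))\<^sup>2 + c"
  have u: "prox_obj \<sigma> \<psi> p u = ereal ?m"
    using sub by (simp add: prox_obj_def has_subgradient_def)
  have ge: "ereal (?m + 1 / (2 * \<sigma>) * (norm (x - u))\<^sup>2) \<le> prox_obj \<sigma> \<psi> p x" for x
    by (rule prox_obj_ge[OF assms])
  have min: "prox_obj \<sigma> \<psi> p u \<le> prox_obj \<sigma> \<psi> p x" for x
    unfolding u by (rule order_trans[OF _ ge]) (use \<sigma> in simp)
  have "x = u" if "x \<in> argmins (prox_obj \<sigma> \<psi> p) UNIV" for x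
  proof -
    have "ereal (?m + 1 / (2 * \<sigma>) * (norm (x - u))\<^sup>2) \<le> ereal ?m"
      using ge[of x] that unfolding u[symmetric] argmins_def by (auto intro: order_trans)
    then show ?thesis using \<sigma> by (simp add: divide_le_0_iff)
  qed
  moreover have "u \<in> argmins (prox_obj \<sigma> \<psi> p) UNIV"
    using min by (simp add: argmins_def)
  ultimately show "prox \<sigma> \<psi> p = u" unfolding prox_def by blast
  have "(INF x. prox_obj \<sigma> \<psi> p x) = prox_obj \<sigma> \<psi> p u"
    by (intro antisym INF_lower INF_greatest min UNIV_I)
  then show "moreau_env \<sigma> \<psi> p = ?m" unfolding moreau_env_def u by simp
qed

text \<open>A point just below the graph is separated from the closed convex epigraph. The
  hyperplane is not vertical, because the graph point straight above lies on its other side, so it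
  can be solved for the last coordinate.\<close>

lemma affine_minorant:
  fixes \<psi> :: "'a::euclidean_space \<Rightarrow> ereal"
  assumes "proper_closed_convex \<psi>"
  obtains a c where "\<And>x. ereal (a \<bullet> x + c) \<le> \<psi> x"
proof -
  have cl: "closed (epi \<psi>)" and cv: "convex (epi \<psi>)" and pr: "proper_fun \<psi>"
    using assms by (auto simp: proper_closed_convex_def)
  obtain x0 r0 where r0: "\<psi> x0 = ereal r0"
    using pr unfolding proper_fun_def by (metis ereal_cases)
  have "(x0, r0 - 1) \<notin> epi \<psi>" by (simp add: epi_def r0)
  then obtain n b where n: "n \<bullet> (x0, r0 - 1) < b" "\<And>z. z \<in> epi \<psi> \<Longrightarrow> n \<bullet> z > b"
    using separating_hyperplane_closed_point[OF cv cl] by metis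
  obtain a \<beta> where ab: "n = (a, \<beta>)" by (cases n)
  have "n \<bullet> (x0, r0) > b" using n(2)[of "(x0, r0)"] by (simp add: epi_def r0)
  then have \<beta>: "\<beta> > 0" using n(1) by (simp add: ab algebra_simps)
  show thesis
  proof
    fix x
    show "ereal ((- (1 / \<beta>) *\<^sub>R a) \<bullet> x + b / \<beta>) \<le> \<psi> x"
    proof (cases "\<psi> x")
      case (real r)
      then have "a \<bullet> x + \<beta> * r > b" using n(2)[of "(x, r)"] by (simp add: epi_def ab)
      then have "(b - a \<bullet> x) / \<beta> < r" using \<beta> by (simp add: pos_divide_less_eq mult.commute)
      then show ?thesis by (simp add: real diff_divide_distrib)
    qed (use pr in \<open>auto simp: proper_fun_def\<close>)
  qed
qed

text \<open>Minimizing the continuous function \<open>h\<close> over the epigraph, rather than the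
  extended-valued objective, turns lower semicontinuity into closedness. Sublevel sets are bounded
  because the quadratic beats the affine minorant.\<close>

lemma prox_minimizer_exists:
  fixes \<psi> :: "'a::euclidean_space \<Rightarrow> ereal"
  assumes \<psi>: "proper_closed_convex \<psi>" and \<sigma>: "\<sigma> > 0"
  obtains u c where "\<psi> u = ereal c"
    "\<And>x r. \<psi> x = ereal r \<Longrightarrow> 1 / (2 * \<sigma>) * (norm (u - p))\<^sup>2 + c \<le> 1 / (2 * \<sigma>) * (norm (x - p))\<^sup>2 + r"
proof -
  have cl: "closed (epi \<psi>)" and pr: "proper_fun \<psi>"
    using \<psi> by (auto simp: proper_closed_convex_def)
  obtain a b where minor: "\<And>x. ereal (a \<bullet> x + b) \<le> \<psi> x" using affine_minorant[OF \<psi>] by blast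
  obtain x0 r0 where r0: "\<psi> x0 = ereal r0"
    using pr unfolding proper_fun_def by (metis ereal_cases)
  define h where "h z = 1 / (2 * \<sigma>) * (norm (fst z - p))\<^sup>2 + snd z" for z :: "'a \<times> real"
  define S where "S = epi \<psi> \<inter> {z. h z \<le> h (x0, r0)}"
  have h: "continuous_on UNIV h" unfolding h_def by (intro continuous_intros)
  define m where "m = h (x0, r0) - b - a \<bullet> p"
  \<comment> \<open>Beyond this radius, t > 1 and t / (2 \<sigma>) > |a| + |m|, so t^2 / (2
    \<sigma>) - |a| t exceeds |m|.\<close>
  define R where "R = 2 * \<sigma> * (norm a + \<bar>m\<bar>) + 1"
  have "bounded S"
  proof -
    have "norm (x - p) \<le> R \<and> \<bar>r\<bar> \<le> \<bar>h (x0, r0)\<bar> + norm a * (R + norm p) + \<bar>b\<bar>" if "(x, r) \<in> S" for x r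
    proof -
      have lower: "a \<bullet> x + b \<le> r"
        using minor[of x] that order_trans[of "ereal (a \<bullet> x + b)" "\<psi> x" "ereal r"]
        by (simp add: S_def epi_def)
      have upper: "1 / (2 * \<sigma>) * (norm (x - p))\<^sup>2 + r \<le> h (x0, r0)"
        using that by (simp add: S_def h_def)
      define t where "t = norm (x - p)"
      have "a \<bullet> (x - p) \<ge> - (norm a * t)"
        using Cauchy_Schwarz_ineq2[of a "x - p"] by (simp add: t_def)
      then have q: "1 / (2 * \<sigma>) * t\<^sup>2 - norm a * t \<le> m"
        using lower upper by (simp add: m_def t_def inner_diff_right)
      have t: "t \<le> R"
      proof (rule ccontr)
        assume "\<not> t \<le> R"
        then have "t > R" by simp
        have R1: "R \<ge> 1" unfolding R_def using \<sigma> by simp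
        then have t1: "t > 1" using \<open>t > R\<close> by simp
        have "2 * \<sigma> * (norm a + \<bar>m\<bar>) < t" using \<open>t > R\<close> by (simp add: R_def)
        then have "norm a + \<bar>m\<bar> < t / (2 * \<sigma>)" using \<sigma> by (simp add: pos_less_divide_eq mult.commute)
        then have "(norm a + \<bar>m\<bar>) * t < t / (2 * \<sigma>) * t" using t1 by (intro mult_strict_right_mono) auto
        moreover have "\<bar>m\<bar> \<le> \<bar>m\<bar> * t" using t1 mult_left_mono[of 1 t "\<bar>m\<bar>"] by simp
        ultimately show False using q by (simp add: distrib_right power2_eq_square)
      qed
      have "norm x \<le> R + norm p"
        using norm_triangle_ineq[of "x - p" p] t by (simp add: t_def)
      then have "\<bar>a \<bullet> x\<bar> \<le> norm a * (R + norm p)"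
        by (intro order_trans[OF Cauchy_Schwarz_ineq2] mult_left_mono) auto
      moreover have "r \<le> h (x0, r0)"
      proof -
        have "0 \<le> 1 / (2 * \<sigma>) * (norm (x - p))\<^sup>2" using \<sigma> by simp
        then show ?thesis using upper by linarith
      qed
      ultimately show ?thesis using lower t by (simp add: t_def)
    qed
    then have "S \<subseteq> cball p R \<times> cball 0 (\<bar>h (x0, r0)\<bar> + norm a * (R + norm p) + \<bar>b\<bar>)"
      by (auto simp: dist_norm norm_minus_commute)
    then show ?thesis using bounded_subset bounded_Times bounded_cball by metis
  qed
  moreover have "closed S"
    unfolding S_def using h by (intro closed_Int cl closed_Collect_le) (auto intro: continuous_on_const)
  ultimately have "compact S" by (simp add: compact_eq_bounded_closed)
  moreover have "(x0, r0) \<in> S" by (simp add: S_def epi_def r0)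
  ultimately obtain z where z: "z \<in> S" "\<And>y. y \<in> S \<Longrightarrow> h z \<le> h y"
    using continuous_attains_inf[of S h] continuous_on_subset[OF h] by blast
  have all: "h z \<le> h y" if "y \<in> epi \<psi>" for y
    using z that by (cases "h y \<le> h (x0, r0)") (auto simp: S_def)
  obtain u r where ur: "z = (u, r)" by (cases z)
  have "\<psi> u \<le> ereal r" using z by (simp add: S_def epi_def ur)
  moreover have "\<psi> u \<noteq> -\<infinity>" using pr by (simp add: proper_fun_def)
  ultimately obtain c where c: "\<psi> u = ereal c" "c \<le> r"
    by (cases "\<psi> u") auto
  show thesis
  proof (rule that[OF c(1)])
    fix x s assume "\<psi> x = ereal s"
    then have "h z \<le> h (x, s)" by (intro all) (simp add: epi_def)
    then show "1 / (2 * \<sigma>) * (norm (u - p))\<^sup>2 + c \<le> 1 / (2 * \<sigma>) * (norm (x - p))\<^sup>2 + s"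
      using c(2) by (simp add: h_def ur)
  qed
qed

lemma convex_epi_le:
  assumes "convex (epi \<psi>)" "\<psi> x = ereal r" "\<psi> u = ereal c" "0 \<le> t" "t \<le> 1"
  shows "\<psi> (u + t *\<^sub>R (x - u)) \<le> ereal (c + t * (r - c))"
proof -
  have "(1 - t) *\<^sub>R (u, c) + t *\<^sub>R (x, r) \<in> epi \<psi>"
    using assms by (intro convexD) (auto simp: epi_def)
  then show ?thesis by (simp add: epi_def algebra_simps)
qed

text \<open>Fermat's rule on segments: compare the minimizer \<open>u\<close> with a point at
  fraction t towards \<open>x\<close>, use convexity and divide by t. The leftover quadratic term is
  proportional to t.\<close>

lemma prox_subgradient_exists:
  fixes \<psi> :: "'a::euclidean_space \<Rightarrow> ereal"
  assumes \<psi>: "proper_closed_convex \<psi>" and \<sigma>: "\<sigma> > 0"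
  obtains u c where "has_subgradient \<psi> u c ((p - u) /\<^sub>R \<sigma>)"
proof -
  have cv: "convex (epi \<psi>)" and pr: "proper_fun \<psi>"
    using \<psi> by (auto simp: proper_closed_convex_def)
  obtain u c where c: "\<psi> u = ereal c" and
    min: "\<And>x r. \<psi> x = ereal r \<Longrightarrow> 1 / (2 * \<sigma>) * (norm (u - p))\<^sup>2 + c \<le> 1 / (2 * \<sigma>) * (norm (x - p))\<^sup>2 + r"
    using prox_minimizer_exists[OF \<psi> \<sigma>, of p] by blast
  have "c + ((p - u) /\<^sub>R \<sigma>) \<bullet> (x - u) \<le> r" if r: "\<psi> x = ereal r" for x r
  proof (rule field_le_epsilon)
    fix e :: real assume e: "e > 0"
    define k where "k = 1 / (2 * \<sigma>) * (norm (x - u))\<^sup>2"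
    have k: "k \<ge> 0" using \<sigma> by (simp add: k_def)
    \<comment> \<open>Chosen so that the leftover \<open>t * k\<close> is at most \<open>e\<close>;
      the added 1 covers \<open>k = 0\<close>.\<close>
    define t where "t = min 1 (e / (k + 1))"
    have t: "0 < t" "t \<le> 1" using e k by (auto simp: t_def add_nonneg_pos)
    have tk: "t * k \<le> e"
    proof -
      have "t * k \<le> e / (k + 1) * (k + 1)" using e k t by (intro mult_mono) (auto simp: t_def)
      then show ?thesis using k by simp
    qed
    obtain s where s: "\<psi> (u + t *\<^sub>R (x - u)) = ereal s" "s \<le> c + t * (r - c)"
      using convex_epi_le[OF cv r c, of t] t pr
      by (cases "\<psi> (u + t *\<^sub>R (x - u))") (auto simp: proper_fun_def)
    have "1 / (2 * \<sigma>) * (norm (u + t *\<^sub>R (x - u) - p))\<^sup>2 + t * (((p - u) /\<^sub>R \<sigma>) \<bullet> (x - u)) =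
        1 / (2 * \<sigma>) * (norm (u - p))\<^sup>2 + t * (t * k)"
      using prox_identity[OF \<sigma>, of "u + t *\<^sub>R (x - u)" p u]
      by (simp add: k_def power_mult_distrib power2_eq_square mult_ac)
    then have "t * (((p - u) /\<^sub>R \<sigma>) \<bullet> (x - u)) \<le> t * (t * k + (r - c))"
      using min[OF s(1)] s(2) by (simp add: distrib_left)
    then have "((p - u) /\<^sub>R \<sigma>) \<bullet> (x - u) \<le> t * k + (r - c)"
      by (rule mult_left_le_imp_le) (rule t)
    then show "c + ((p - u) /\<^sub>R \<sigma>) \<bullet> (x - u) \<le> r + e" using tk by linarith
  qed
  then have "ereal (c + ((p - u) /\<^sub>R \<sigma>) \<bullet> (x - u)) \<le> \<psi> x" for x
    using pr by (cases "\<psi> x") (auto simp: proper_fun_def)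
  then show thesis using c that unfolding has_subgradient_def by blast
qed

lemma prox_has_subgradient:
  fixes \<psi> :: "'a::euclidean_space \<Rightarrow> ereal"
  assumes "proper_closed_convex \<psi>" "\<sigma> > 0"
  obtains c where "has_subgradient \<psi> (prox \<sigma> \<psi> p) c ((p - prox \<sigma> \<psi> p) /\<^sub>R \<sigma>)"
    "moreau_env \<sigma> \<psi> p = 1 / (2 * \<sigma>) * (norm (prox \<sigma> \<psi> p - p))\<^sup>2 + c"
proof -
  obtain u c where "has_subgradient \<psi> u c ((p - u) /\<^sub>R \<sigma>)"
    using prox_subgradient_exists[OF assms] .
  then show thesis using that prox_eqI[OF assms(2)] by metis
qed

lemma moreau_env_le:
  fixes \<psi> :: "'a::euclidean_space \<Rightarrow> ereal"
  assumes \<psi>: "proper_closed_convex \<psi>" "\<sigma> > 0" and x: "\<psi> x = ereal r"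
  shows "moreau_env \<sigma> \<psi> p \<le> 1 / (2 * \<sigma>) * (norm (x - p))\<^sup>2 + r"
proof -
  obtain c where c: "has_subgradient \<psi> (prox \<sigma> \<psi> p) c ((p - prox \<sigma> \<psi> p) /\<^sub>R \<sigma>)"
    "moreau_env \<sigma> \<psi> p = 1 / (2 * \<sigma>) * (norm (prox \<sigma> \<psi> p - p))\<^sup>2 + c"
    using prox_has_subgradient[OF \<psi>] .
  have "0 \<le> 1 / (2 * \<sigma>) * (norm (x - prox \<sigma> \<psi> p))\<^sup>2" using \<psi>(2) by simp
  then show ?thesis
    using prox_obj_ge[OF \<psi>(2) c(1), of x] c(2) by (simp add: prox_obj_def x)
qed

text \<open>For the lower bound the subgradient at \<open>u\<close> is tested at \<open>w\<close>,
  and the quadratic terms differ from the tangent by a perfect square. For the upper bound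
  \<open>u\<close> serves as a competitor in the problem at \<open>q\<close>.\<close>

lemma smooth_convex_moreau_env:
  fixes \<psi> :: "'a::euclidean_space \<Rightarrow> ereal"
  assumes \<psi>: "proper_closed_convex \<psi>" "\<sigma> > 0"
  shows "smooth_convex (1 / \<sigma>) (moreau_env \<sigma> \<psi>) (\<lambda>p. (p - prox \<sigma> \<psi> p) /\<^sub>R \<sigma>)"
  unfolding smooth_convex_def
proof (intro allI)
  fix p q
  define u where "u = prox \<sigma> \<psi> p"
  define w where "w = prox \<sigma> \<psi> q"
  obtain c where c: "has_subgradient \<psi> u c ((p - u) /\<^sub>R \<sigma>)"
    "moreau_env \<sigma> \<psi> p = 1 / (2 * \<sigma>) * (norm (u - p))\<^sup>2 + c"
    using prox_has_subgradient[OF \<psi>, of p] unfolding u_def .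
  obtain e where e: "has_subgradient \<psi> w e ((q - w) /\<^sub>R \<sigma>)"
    "moreau_env \<sigma> \<psi> q = 1 / (2 * \<sigma>) * (norm (w - q))\<^sup>2 + e"
    using prox_has_subgradient[OF \<psi>, of q] unfolding w_def .
  have "ereal (c + ((p - u) /\<^sub>R \<sigma>) \<bullet> (w - u)) \<le> \<psi> w"
    using c(1) unfolding has_subgradient_def by blast
  then have ce: "c + ((p - u) /\<^sub>R \<sigma>) \<bullet> (w - u) \<le> e"
    using e(1) by (simp add: has_subgradient_def)
  have uc: "\<psi> u = ereal c" using c(1) by (simp add: has_subgradient_def)
  have "1 / (2 * \<sigma>) * (norm (w - q))\<^sup>2 + ((p - u) /\<^sub>R \<sigma>) \<bullet> (w - u)
      = 1 / (2 * \<sigma>) * (norm (u - p))\<^sup>2 + ((p - u) /\<^sub>R \<sigma>) \<bullet> (q - p)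
        + 1 / (2 * \<sigma>) * (norm ((p - u) - (q - w)))\<^sup>2"
  proof -
    have "(norm (w - q))\<^sup>2 + 2 * ((p - u) \<bullet> (w - u))
      = (norm (u - p))\<^sup>2 + 2 * ((p - u) \<bullet> (q - p)) + (norm ((p - u) - (q - w)))\<^sup>2"
      by (simp add: power2_norm_eq_inner inner_diff_left inner_diff_right inner_commute)
    then have "1 / (2 * \<sigma>) * ((norm (w - q))\<^sup>2 + 2 * ((p - u) \<bullet> (w - u)))
      = 1 / (2 * \<sigma>) * ((norm (u - p))\<^sup>2 + 2 * ((p - u) \<bullet> (q - p)) + (norm ((p - u) - (q - w)))\<^sup>2)"
      by simp
    then show ?thesis using \<psi>(2) by (simp add: distrib_left inverse_eq_divide)
  qed
  moreover have "0 \<le> 1 / (2 * \<sigma>) * (norm ((p - u) - (q - w)))\<^sup>2" using \<psi>(2) by simp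
  ultimately have 1: "moreau_env \<sigma> \<psi> p + ((p - u) /\<^sub>R \<sigma>) \<bullet> (q - p) \<le> moreau_env \<sigma> \<psi> q"
    unfolding c(2) e(2) using ce by linarith
  have "1 / (2 * \<sigma>) * (norm (u - q))\<^sup>2 = 1 / (2 * \<sigma>) * (norm (u - p))\<^sup>2 + ((p - u) /\<^sub>R \<sigma>) \<bullet> (q - p)
      + 1 / \<sigma> / 2 * (norm (q - p))\<^sup>2"
  proof -
    have "(norm (u - q))\<^sup>2 = (norm (u - p))\<^sup>2 + 2 * ((p - u) \<bullet> (q - p)) + (norm (q - p))\<^sup>2"
      by (simp add: power2_norm_eq_inner inner_diff_left inner_diff_right inner_commute)
    then show ?thesis using \<psi>(2) by (simp add: distrib_left inverse_eq_divide add_divide_distrib)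
  qed
  then have 2: "moreau_env \<sigma> \<psi> q \<le> moreau_env \<sigma> \<psi> p + ((p - u) /\<^sub>R \<sigma>) \<bullet> (q - p) + 1 / \<sigma> / 2 * (norm (q - p))\<^sup>2"
    using moreau_env_le[OF \<psi> uc, of q] unfolding c(2) by linarith
  show "moreau_env \<sigma> \<psi> p + ((p - prox \<sigma> \<psi> p) /\<^sub>R \<sigma>) \<bullet> (q - p) \<le> moreau_env \<sigma> \<psi> q \<and>
    moreau_env \<sigma> \<psi> q \<le> moreau_env \<sigma> \<psi> p + ((p - prox \<sigma> \<psi> p) /\<^sub>R \<sigma>) \<bullet> (q - p) + 1 / \<sigma> / 2 * (norm (q - p))\<^sup>2"
    using 1 2 by (simp add: u_def)
qed

section \<open>Conjugates, coercivity and the Moreau decomposition\<close>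

lemma fenchel_conj_ge: "ereal (v \<bullet> x) - \<psi> x \<le> fenchel_conj \<psi> v"
  unfolding fenchel_conj_def by (rule SUP_upper) simp

lemma fenchel_conj_ge_real: "\<psi> x = ereal r \<Longrightarrow> ereal (v \<bullet> x - r) \<le> fenchel_conj \<psi> v"
  using fenchel_conj_ge[of v x \<psi>] by simp

text \<open>Inversion of subgradients: the subgradient inequality at \<open>u\<close> is equality in
  Fenchel-Young, and the conjugate dominates the affine function that \<open>u\<close>
  generates.\<close>

lemma has_subgradient_fenchel_conj:
  assumes sub: "has_subgradient \<psi> u c v"
  shows "has_subgradient (fenchel_conj \<psi>) v (u \<bullet> v - c) u"
proof -
  have u: "\<psi> u = ereal c" using sub by (simp add: has_subgradient_def)
  have "fenchel_conj \<psi> v \<le> ereal (u \<bullet> v - c)"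
    unfolding fenchel_conj_def
  proof (rule SUP_least)
    fix x
    have "ereal (c + v \<bullet> (x - u)) \<le> \<psi> x" using sub unfolding has_subgradient_def by blast
    then show "ereal (v \<bullet> x) - \<psi> x \<le> ereal (u \<bullet> v - c)"
      by (cases "\<psi> x") (auto simp: inner_diff_right inner_commute)
  qed
  then have "fenchel_conj \<psi> v = ereal (u \<bullet> v - c)"
    using fenchel_conj_ge_real[of \<psi> u c v, OF u] by (simp add: inner_commute antisym)
  moreover have "ereal (u \<bullet> v - c + u \<bullet> (y - v)) \<le> fenchel_conj \<psi> y" for y
    using fenchel_conj_ge_real[of \<psi> u c y, OF u] by (simp add: inner_diff_right inner_commute)
  ultimately show ?thesis by (simp add: has_subgradient_def)
qed

lemma fenchel_conj_convex:
  assumes a: "fenchel_conj \<psi> a = ereal r" and b: "fenchel_conj \<psi> b = ereal s"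
    and that: "0 \<le> t" "t \<le> 1"
  shows "fenchel_conj \<psi> ((1 - t) *\<^sub>R a + t *\<^sub>R b) \<le> ereal ((1 - t) * r + t * s)"
  unfolding fenchel_conj_def
proof (rule SUP_least)
  fix x
  have 1: "ereal (a \<bullet> x) - \<psi> x \<le> ereal r" "ereal (b \<bullet> x) - \<psi> x \<le> ereal s"
    using fenchel_conj_ge[of a x \<psi>] fenchel_conj_ge[of b x \<psi>] a b by auto
  show "ereal (((1 - t) *\<^sub>R a + t *\<^sub>R b) \<bullet> x) - \<psi> x \<le> ereal ((1 - t) * r + t * s)"
  proof (cases "\<psi> x")
    case (real q)
    have "(1 - t) * (a \<bullet> x - q) + t * (b \<bullet> x - q) \<le> (1 - t) * r + t * s"
      using 1 that real by (intro add_mono mult_left_mono) auto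
    then show ?thesis by (simp add: real inner_add_left algebra_simps)
  qed (use 1 in auto)
qed

lemma superlinear_minorant:
  fixes f :: "'a::euclidean_space \<Rightarrow> ereal"
  assumes f: "proper_closed_convex f" and co: "coercive_fun f"
  obtains c where "\<And>x. ereal (K * norm x - c) \<le> f x"
proof -
  obtain a b where minor: "\<And>x. ereal (a \<bullet> x + b) \<le> f x" using affine_minorant[OF f] by blast
  have "\<forall>\<^sub>F x in at_infinity. ereal K < f x / ereal (norm x)"
    using co unfolding coercive_fun_def by (intro less_LiminfD) simp
  then obtain R where R: "\<And>x. R \<le> norm x \<Longrightarrow> ereal K < f x / ereal (norm x)"
    unfolding eventually_at_infinity by blast
  \<comment> \<open>A radius of at least 1 keeps the denominator of the coercivity quotient
    positive.\<close>
  define R' where "R' = max R 1"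
  define c where "c = \<bar>K\<bar> * R' + norm a * R' + \<bar>b\<bar>"
  have c0: "c \<ge> 0" by (simp add: c_def R'_def)
  show thesis
  proof
    fix x
    show "ereal (K * norm x - c) \<le> f x"
    proof (cases "norm x \<ge> R'")
      case True
      then have "0 < ereal (norm x)" "ereal K \<le> f x / ereal (norm x)"
        using R[of x] by (auto simp: R'_def)
      then have "ereal (norm x) * ereal K \<le> f x"
        using ereal_le_divide_pos[of "ereal (norm x)" "ereal K" "f x"] by simp
      moreover have "ereal (K * norm x - c) \<le> ereal (norm x) * ereal K"
        using c0 by (simp add: mult.commute)
      ultimately show ?thesis by (rule order_trans[rotated])
    next
      case False
      have "K * norm x \<le> \<bar>K\<bar> * R'"
        using False by (intro mult_mono) auto
      moreover have "- (norm a * R') \<le> a \<bullet> x"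
      proof -
        have "\<bar>a \<bullet> x\<bar> \<le> norm a * R'"
          using False by (intro order_trans[OF Cauchy_Schwarz_ineq2] mult_left_mono) auto
        then show ?thesis by linarith
      qed
      ultimately have "K * norm x - c \<le> a \<bullet> x + b" unfolding c_def by linarith
      then show ?thesis using minor[of x] order_trans by (metis ereal_less_eq(3))
    qed
  qed
qed

text \<open>A minorant of \<open>f\<close> with slope \<open>norm v\<close> absorbs the linear term
  in the supremum; any point of the domain bounds it from below.\<close>

lemma fenchel_conj_finite:
  fixes f :: "'a::euclidean_space \<Rightarrow> ereal"
  assumes f: "proper_closed_convex f" and co: "coercive_fun f"
  shows "\<exists>r. fenchel_conj f v = ereal r"
proof -
  obtain c where c: "\<And>x. ereal (norm v * norm x - c) \<le> f x"
    using superlinear_minorant[OF f co] by blast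
  have "fenchel_conj f v \<le> ereal c"
    unfolding fenchel_conj_def
  proof (rule SUP_least)
    fix x
    show "ereal (v \<bullet> x) - f x \<le> ereal c"
      using c[of x] norm_cauchy_schwarz[of v x] by (cases "f x") auto
  qed
  moreover obtain x0 r0 where "f x0 = ereal r0"
    using f unfolding proper_closed_convex_def proper_fun_def by (metis ereal_cases)
  then have "ereal (v \<bullet> x0 - r0) \<le> fenchel_conj f v" by (rule fenchel_conj_ge_real)
  ultimately show ?thesis by (cases "fenchel_conj f v") auto
qed

lemma fenchel_conj_continuous:
  fixes f :: "'a::euclidean_space \<Rightarrow> ereal"
  assumes fin: "\<And>v. fenchel_conj f v = ereal (F v)"
  shows "continuous_on UNIV F"
proof (rule convex_on_continuous)
  show "convex_on UNIV F"
  proof (rule convex_onI)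
    fix t :: real and x y assume "0 < t" "t < 1"
    then show "F ((1 - t) *\<^sub>R x + t *\<^sub>R y) \<le> (1 - t) * F x + t * F y"
      using fenchel_conj_convex[OF fin fin, of t x y] fin \<open>0 < t\<close> \<open>t < 1\<close> by simp
  qed simp
qed simp

text \<open>The proximal point \<open>u\<close> splits |p| into |u| and |u - p|: superlinearity of
  \<open>f\<close> pays for the first, and Young's inequality absorbs the second into the quadratic
  at the cost \<sigma> K^2 / 2.\<close>

lemma moreau_env_superlinear:
  fixes f :: "'a::euclidean_space \<Rightarrow> ereal"
  assumes f: "proper_closed_convex f" and co: "coercive_fun f" and \<sigma>: "\<sigma> > 0"
  obtains c where "\<And>p. K * norm p - c \<le> moreau_env \<sigma> f p"
proof -
  obtain c where c: "\<And>x. ereal (\<bar>K\<bar> * norm x - c) \<le> f x"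
    using superlinear_minorant[OF f co] by blast
  show thesis
  proof
    fix p
    define u where "u = prox \<sigma> f p"
    obtain r where r: "has_subgradient f u r ((p - u) /\<^sub>R \<sigma>)"
      "moreau_env \<sigma> f p = 1 / (2 * \<sigma>) * (norm (u - p))\<^sup>2 + r"
      using prox_has_subgradient[OF f \<sigma>, of p] unfolding u_def .
    have "\<bar>K\<bar> * norm u - c \<le> r" using c[of u] r(1) by (simp add: has_subgradient_def)
    moreover have "\<bar>K\<bar> * norm p \<le> \<bar>K\<bar> * norm u + \<bar>K\<bar> * norm (u - p)"
      using mult_left_mono[OF norm_triangle_ineq4[of u "u - p"], of "\<bar>K\<bar>"] by (simp add: distrib_left)
    moreover have "\<bar>K\<bar> * norm (u - p) \<le> 1 / (2 * \<sigma>) * (norm (u - p))\<^sup>2 + \<sigma> * K\<^sup>2 / 2"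
    proof -
      have "0 \<le> (norm (u - p) - \<sigma> * \<bar>K\<bar>)\<^sup>2" by simp
      also have "\<dots> = (norm (u - p))\<^sup>2 + \<sigma> * (\<sigma> * K\<^sup>2) - 2 * \<sigma> * (\<bar>K\<bar> * norm (u - p))"
        unfolding power2_diff power_mult_distrib power2_abs by (simp add: power2_eq_square)
      finally have "2 * \<sigma> * (\<bar>K\<bar> * norm (u - p)) \<le> (norm (u - p))\<^sup>2 + \<sigma> * (\<sigma> * K\<^sup>2)"
        by simp
      then have "1 / (2 * \<sigma>) * (2 * \<sigma> * (\<bar>K\<bar> * norm (u - p)))
          \<le> 1 / (2 * \<sigma>) * ((norm (u - p))\<^sup>2 + \<sigma> * (\<sigma> * K\<^sup>2))"
        using \<sigma> by (intro mult_left_mono) auto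
      then show ?thesis using \<sigma> by (simp add: distrib_left)
    qed
    moreover have "K * norm p \<le> \<bar>K\<bar> * norm p" by (simp add: mult_right_mono)
    ultimately show "K * norm p - (c + \<sigma> * K\<^sup>2 / 2) \<le> moreau_env \<sigma> f p"
      unfolding r(2) by linarith
  qed
qed

text \<open>The conjugate of the envelope with parameter \<open>1/\<gamma>\<close> is \<open>\<psi>\<^sup>* + \<parallel>\<cdot>\<parallel>\<^sup>2 / (2\<gamma>)\<close>.\<close>

lemma moreau_env_fenchel_young:
  fixes \<psi> :: "'a::euclidean_space \<Rightarrow> ereal"
  assumes \<psi>: "proper_closed_convex \<psi>" and \<gamma>: "\<gamma> > 0" and v: "fenchel_conj \<psi> v = ereal r"
  shows "q \<bullet> v \<le> moreau_env (1 / \<gamma>) \<psi> q + r + 1 / (2 * \<gamma>) * (norm v)\<^sup>2"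
proof -
  have "1 / \<gamma> > 0" using \<gamma> by simp
  define u where "u = prox (1 / \<gamma>) \<psi> q"
  obtain c where c: "has_subgradient \<psi> u c ((q - u) /\<^sub>R (1 / \<gamma>))"
      "moreau_env (1 / \<gamma>) \<psi> q = 1 / (2 * (1 / \<gamma>)) * (norm (u - q))\<^sup>2 + c"
    using prox_has_subgradient[OF \<psi> \<open>1 / \<gamma> > 0\<close>, of q] unfolding u_def .
  have "ereal (v \<bullet> u - c) \<le> ereal r"
    using fenchel_conj_ge_real[of \<psi> u c v] c(1) v by (simp add: has_subgradient_def)
  then have "v \<bullet> u - c \<le> r" by simp
  moreover have "(q - u) \<bullet> v \<le> \<gamma> / 2 * (norm (u - q))\<^sup>2 + 1 / (2 * \<gamma>) * (norm v)\<^sup>2"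
  proof -
    have "0 \<le> (norm (\<gamma> *\<^sub>R (q - u) - v))\<^sup>2" by simp
    also have "\<dots> = \<gamma>\<^sup>2 * (norm (u - q))\<^sup>2 + (norm v)\<^sup>2 - 2 * \<gamma> * ((q - u) \<bullet> v)"
      unfolding norm_minus_commute[of u q] power2_norm_eq_inner
      by (simp add: inner_diff_left inner_diff_right inner_commute power2_eq_square algebra_simps)
    finally have "1 / (2 * \<gamma>) * (2 * \<gamma> * ((q - u) \<bullet> v)) \<le> 1 / (2 * \<gamma>) * (\<gamma>\<^sup>2 * (norm (u - q))\<^sup>2 + (norm v)\<^sup>2)"
      using \<gamma> by (intro mult_left_mono) auto
    then show ?thesis using \<gamma> by (simp add: distrib_left power2_eq_square)
  qed
  ultimately show ?thesis
    unfolding c(2) by (simp add: inner_diff_left inner_commute[of v])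
qed

text \<open>The equality case, attained at the gradient \<open>v\<close> of the envelope. It is a
  subgradient of \<psi> at the proximal point, and inverting that relation also yields the Moreau
  decomposition in the last clause.\<close>

lemma moreau_env_fenchel_eq:
  fixes \<psi> :: "'a::euclidean_space \<Rightarrow> ereal" and q :: 'a
  assumes \<psi>: "proper_closed_convex \<psi>" and \<gamma>: "\<gamma> > 0"
  defines "v \<equiv> \<gamma> *\<^sub>R (q - prox (1 / \<gamma>) \<psi> q)"
  obtains r where "fenchel_conj \<psi> v = ereal r"
    "moreau_env (1 / \<gamma>) \<psi> q + r + 1 / (2 * \<gamma>) * (norm v)\<^sup>2 = q \<bullet> v"
    "prox \<gamma> (fenchel_conj \<psi>) (\<gamma> *\<^sub>R q) = v"
proof -
  have "1 / \<gamma> > 0" using \<gamma> by simp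
  define u where "u = prox (1 / \<gamma>) \<psi> q"
  obtain c where c: "has_subgradient \<psi> u c ((q - u) /\<^sub>R (1 / \<gamma>))"
      "moreau_env (1 / \<gamma>) \<psi> q = 1 / (2 * (1 / \<gamma>)) * (norm (u - q))\<^sup>2 + c"
    using prox_has_subgradient[OF \<psi> \<open>1 / \<gamma> > 0\<close>, of q] unfolding u_def .
  have v: "v = (q - u) /\<^sub>R (1 / \<gamma>)" by (simp add: v_def u_def)
  have conj: "has_subgradient (fenchel_conj \<psi>) v (u \<bullet> v - c) u"
    using has_subgradient_fenchel_conj[OF c(1)] by (simp only: v)
  have "u = (\<gamma> *\<^sub>R q - v) /\<^sub>R \<gamma>" using \<gamma> by (simp add: v algebra_simps)
  then have "prox \<gamma> (fenchel_conj \<psi>) (\<gamma> *\<^sub>R q) = v"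
    using conj by (intro prox_eqI(1)[OF \<gamma>, where c = "u \<bullet> v - c"]) simp
  moreover have "moreau_env (1 / \<gamma>) \<psi> q + (u \<bullet> v - c) + 1 / (2 * \<gamma>) * (norm v)\<^sup>2 = q \<bullet> v"
  proof -
    have "\<gamma> / 2 * (norm (u - q))\<^sup>2 + 1 / (2 * \<gamma>) * (norm v)\<^sup>2 = (q - u) \<bullet> v"
      using \<gamma> by (simp add: v norm_minus_commute[of u q] power_mult_distrib dot_square_norm power2_eq_square)
    then show ?thesis unfolding c(2) by (simp add: inner_diff_left)
  qed
  ultimately show thesis using that conj by (simp add: has_subgradient_def)
qed

subsection \<open>The primal and dual subproblems\<close>

lemma inner_QT: "QT A B w \<bullet> x = fst w \<bullet> (A *v x) + snd w \<bullet> (B *v x)"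
proof -
  have "linear (Qmap A B)"
    by (intro linearI) (simp_all add: Qmap_def matrix_vector_right_distrib matrix_vector_mult_scaleR)
  from adjoint_works[OF this, of x w] show ?thesis
    by (cases w) (simp add: QT_def Qmap_def inner_commute)
qed

lemma QT_eq: "QT A B w = fst w v* A + snd w v* B"
  by (rule vector_eq_rdot[THEN iffD1]) (simp add: inner_QT inner_add_left dot_lmul_matrix)

lemma linear_QT: "linear (QT A B)"
proof (rule linearI)
  show "QT A B (w + w') = QT A B w + QT A B w'" for w w'
    by (rule vector_eq_rdot[THEN iffD1]) (simp add: inner_QT inner_add_left)
  show "QT A B (c *\<^sub>R w) = c *\<^sub>R QT A B w" for c w
    by (rule vector_eq_rdot[THEN iffD1]) (simp add: inner_QT distrib_left)
qed

lemma inner_Mmap: "w \<bullet> Mmap A B w = (norm (QT A B w))\<^sup>2 + (norm w)\<^sup>2"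
proof -
  have "w \<bullet> Qmap A B (QT A B w) = (norm (QT A B w))\<^sup>2"
    unfolding power2_norm_eq_inner inner_QT by (cases w) (simp add: Qmap_def)
  then show ?thesis by (simp add: Mmap_def inner_add_right power2_norm_eq_inner)
qed

lemma restr_add: "restr T (x + y) = restr T x + restr T y"
  by (simp add: restr_def vec_eq_iff)

lemma restr_scaleR: "restr T (c *\<^sub>R x) = c *\<^sub>R restr T x"
  by (simp add: restr_def vec_eq_iff)

lemma rows_on_mult: "rows_on T B *v x = restr T (B *v x)"
  by (simp add: rows_on_def restr_def vec_eq_iff matrix_vector_mul_component)

lemma inner_restr: "restr T x \<bullet> y = x \<bullet> restr T y"
  unfolding inner_vec_def restr_def by (intro sum.cong) auto

lemma restr_restr [simp]: "restr T (restr T x) = restr T x"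
  by (simp add: restr_def vec_eq_iff)

lemma norm_restr_le: "norm (restr T x) \<le> norm x"
  by (intro norm_le_componentwise_cart) (simp add: restr_def)

lemma D_feasible_iff: "w \<in> D_feasible T \<longleftrightarrow> restr T (snd w) = snd w"
  by (cases w) (auto simp: D_feasible_def restr_def vec_eq_iff)

section \<open>Gradient, curvature and level sets of the primal objective\<close>

lemma smooth_convex_moreau_env_inverse:
  fixes \<psi> :: "'a::euclidean_space \<Rightarrow> ereal"
  assumes "proper_closed_convex \<psi>" "\<gamma> > 0"
  shows "smooth_convex \<gamma> (moreau_env (1 / \<gamma>) \<psi>) (\<lambda>q. \<gamma> *\<^sub>R (q - prox (1 / \<gamma>) \<psi> q))"
  using smooth_convex_moreau_env[OF assms(1), of "1 / \<gamma>"] assms(2) by simp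

definition f_k_grad :: "(real^'n \<Rightarrow> ereal) \<Rightarrow> real^'n^'m \<Rightarrow> real^'n^'p \<Rightarrow> real \<Rightarrow>
    (real^'m) \<times> (real^'p) \<Rightarrow> real^'n \<Rightarrow> real^'n" where
  "f_k_grad f A B \<gamma> wk x =
     \<gamma> *\<^sub>R (x - QT A B wk /\<^sub>R \<gamma> - prox (1 / \<gamma>) f (x - QT A B wk /\<^sub>R \<gamma>))"

definition g_k_grad :: "(real^'m \<Rightarrow> ereal) \<Rightarrow> real \<Rightarrow> real^'m \<Rightarrow> real^'m \<Rightarrow> real^'m" where
  "g_k_grad g \<gamma> yk u = \<gamma> *\<^sub>R (u + yk /\<^sub>R \<gamma> - prox (1 / \<gamma>) g (u + yk /\<^sub>R \<gamma>))"

definition h_k_grad :: "real \<Rightarrow> real^'p \<Rightarrow> 'p set \<Rightarrow> real^'p \<Rightarrow> real^'p" where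
  "h_k_grad \<gamma> zk T v = restr T zk + \<gamma> *\<^sub>R restr T v"

text \<open>Writing the gradient through the recovered dual point w makes -Q^T w = v - G, with v the
  gradient of f_k, true by definition.\<close>

definition Psi_k_grad :: "(real^'n \<Rightarrow> ereal) \<Rightarrow> (real^'m \<Rightarrow> ereal) \<Rightarrow> real^'n^'m \<Rightarrow> real^'n^'p \<Rightarrow>
    real \<Rightarrow> (real^'m) \<times> (real^'p) \<Rightarrow> 'p set \<Rightarrow> real^'n \<Rightarrow> real^'n" where
  "Psi_k_grad f g A B \<gamma> wk T x =
     f_k_grad f A B \<gamma> wk x + QT A B (dual_recovery g A B \<gamma> wk T x)"

lemma smooth_convex_f_k:
  assumes "proper_closed_convex f" "\<gamma> > 0"
  shows "smooth_convex \<gamma> (f_k f A B \<gamma> wk) (f_k_grad f A B \<gamma> wk)"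
  using smooth_convex_add_const[OF smooth_convex_shift[OF smooth_convex_moreau_env_inverse[OF assms],
        of "- (QT A B wk /\<^sub>R \<gamma>)"], of "- (1 / (2 * \<gamma>) * (norm (QT A B wk))\<^sup>2)"]
  unfolding f_k_def[abs_def] f_k_grad_def[abs_def] by simp

lemma smooth_convex_g_k:
  assumes "proper_closed_convex g" "\<gamma> > 0"
  shows "smooth_convex \<gamma> (g_k g \<gamma> yk) (g_k_grad g \<gamma> yk)"
  using smooth_convex_add_const[OF smooth_convex_shift[OF smooth_convex_moreau_env_inverse[OF assms],
        of "yk /\<^sub>R \<gamma>"], of "- (1 / (2 * \<gamma>) * (norm yk)\<^sup>2)"]
  unfolding g_k_def[abs_def] g_k_grad_def[abs_def] by simp

lemma smooth_convex_h_k: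
  assumes "\<gamma> > 0"
  shows "smooth_convex \<gamma> (h_k \<gamma> zk T) (h_k_grad \<gamma> zk T)"
  unfolding smooth_convex_def
proof (intro allI)
  fix v v' :: "real^'a"
  define r where "r = restr T (v + zk /\<^sub>R \<gamma>)"
  define d where "d = v' - v"
  have "v' + zk /\<^sub>R \<gamma> = (v + zk /\<^sub>R \<gamma>) + d" by (simp add: d_def)
  then have "restr T (v' + zk /\<^sub>R \<gamma>) = r + restr T d" unfolding r_def by (simp only: restr_add)
  moreover have "(norm (r + restr T d))\<^sup>2 = (norm r)\<^sup>2 + 2 * (r \<bullet> d) + (norm (restr T d))\<^sup>2"
  proof -
    have "r \<bullet> restr T d = r \<bullet> d" by (simp add: r_def inner_restr[symmetric])
    then show ?thesis by (simp add: power2_norm_eq_inner inner_add_left inner_add_right inner_commute)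
  qed
  moreover have "h_k_grad \<gamma> zk T v \<bullet> d = \<gamma> * (r \<bullet> d)"
    using assms by (simp add: h_k_grad_def r_def restr_add restr_scaleR inner_add_left distrib_left)
  ultimately have eq: "h_k \<gamma> zk T v' = h_k \<gamma> zk T v + h_k_grad \<gamma> zk T v \<bullet> d + \<gamma> / 2 * (norm (restr T d))\<^sup>2"
    unfolding h_k_def r_def[symmetric] by (simp add: distrib_left)
  have "\<gamma> / 2 * (norm (restr T d))\<^sup>2 \<le> \<gamma> / 2 * (norm d)\<^sup>2"
    using assms by (intro mult_left_mono power_mono norm_restr_le) auto
  moreover have "0 \<le> \<gamma> / 2 * (norm (restr T d))\<^sup>2" using assms by simp
  ultimately show "h_k \<gamma> zk T v + h_k_grad \<gamma> zk T v \<bullet> (v' - v) \<le> h_k \<gamma> zk T v' \<and>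
      h_k \<gamma> zk T v' \<le> h_k \<gamma> zk T v + h_k_grad \<gamma> zk T v \<bullet> (v' - v) + \<gamma> / 2 * (norm (v' - v))\<^sup>2"
    unfolding eq d_def by linarith
qed

text \<open>By the Moreau decomposition, dual recovery evaluates the gradients of g_k and h_k at A x
  and B x; this links the algorithm's formula to the chain rule for \<Psi>.\<close>

lemma dual_recovery_eq:
  assumes g: "proper_closed_convex g" and \<gamma>: "\<gamma> > 0"
  shows "dual_recovery g A B \<gamma> wk T x =
    (g_k_grad g \<gamma> (fst wk) (A *v x), h_k_grad \<gamma> (snd wk) T (B *v x))"
proof -
  let ?q = "A *v x + fst wk /\<^sub>R \<gamma>"
  have "prox \<gamma> (fenchel_conj g) (\<gamma> *\<^sub>R ?q) = \<gamma> *\<^sub>R (?q - prox (1 / \<gamma>) g ?q)"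
    using moreau_env_fenchel_eq[OF g \<gamma>, of ?q] by metis
  moreover have "\<gamma> *\<^sub>R ?q = \<gamma> *\<^sub>R (A *v x) + fst wk" using \<gamma> by (simp add: scaleR_add_right)
  ultimately show ?thesis
    unfolding dual_recovery_def g_k_grad_def h_k_grad_def rows_on_mult by simp
qed

lemma dual_recovery_feasible: "dual_recovery g A B \<gamma> wk T x \<in> D_feasible T"
  by (simp add: D_feasible_iff dual_recovery_def rows_on_mult restr_add restr_scaleR)

text \<open>One constant serves both as Lipschitz modulus of the gradient and as bound on the
  generalized Hessians; \<gamma> is the modulus of each summand, and composition multiplies it by a
  squared operator norm.\<close>

definition Psi_k_modulus :: "real^'n^'m \<Rightarrow> real^'n^'p \<Rightarrow> real \<Rightarrow> real" where
  "Psi_k_modulus A B \<gamma> = \<gamma> + \<gamma> * (onorm ((*v) A))\<^sup>2 + \<gamma> * (onorm ((*v) B))\<^sup>2"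

lemma Psi_k_modulus_pos: "\<gamma> > 0 \<Longrightarrow> Psi_k_modulus A B \<gamma> > 0"
  unfolding Psi_k_modulus_def by (intro add_pos_nonneg) auto

lemma smooth_convex_Psi_k:
  assumes f: "proper_closed_convex f" and g: "proper_closed_convex g" and \<gamma>: "\<gamma> > 0"
  shows "smooth_convex (Psi_k_modulus A B \<gamma>) (Psi_k f g A B \<gamma> wk T) (Psi_k_grad f g A B \<gamma> wk T)"
proof -
  have 1: "smooth_convex (\<gamma> * (onorm ((*v) A))\<^sup>2) (\<lambda>x. g_k g \<gamma> (fst wk) (A *v x))
      (\<lambda>x. g_k_grad g \<gamma> (fst wk) (A *v x) v* A)"
    by (rule smooth_convex_compose[OF smooth_convex_g_k[OF g \<gamma>]])
      (use \<gamma> in \<open>auto simp: dot_lmul_matrix intro: onorm\<close>)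
  have 2: "smooth_convex (\<gamma> * (onorm ((*v) B))\<^sup>2) (\<lambda>x. h_k \<gamma> (snd wk) T (B *v x))
      (\<lambda>x. h_k_grad \<gamma> (snd wk) T (B *v x) v* B)"
    by (rule smooth_convex_compose[OF smooth_convex_h_k[OF \<gamma>]])
      (use \<gamma> in \<open>auto simp: dot_lmul_matrix intro: onorm\<close>)
  from smooth_convex_add[OF smooth_convex_add[OF smooth_convex_f_k[OF f \<gamma>] 1] 2]
  show ?thesis
    unfolding Psi_k_modulus_def Psi_k_def[abs_def] Psi_k_grad_def[abs_def]
    by (simp add: dual_recovery_eq[OF g \<gamma>] QT_eq[of A B "(_, _)"] add.assoc)
qed

lemma gen_hessian_psd_bounded:
  assumes f: "proper_closed_convex f" and g: "proper_closed_convex g" and \<gamma>: "\<gamma> > 0"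
    and H: "H \<in> gen_hessian f g A B \<gamma> wk T x"
  shows "psd_bounded (Psi_k_modulus A B \<gamma>) H"
proof -
  obtain U V where UV: "U \<in> clarke_jacobian (grad (f_k f A B \<gamma> wk)) x"
    "V \<in> clarke_jacobian (grad (g_k g \<gamma> (fst wk))) (A *v x)"
    and H: "H = U + transpose A ** V ** A + \<gamma> *\<^sub>R (transpose (rows_on T B) ** rows_on T B)"
    using H unfolding gen_hessian_def by blast
  note fk = smooth_convex_f_k[OF f \<gamma>, of A B wk] and gk = smooth_convex_g_k[OF g \<gamma>, of "fst wk"]
  have "psd_bounded \<gamma> U" "psd_bounded \<gamma> V"
    using UV clarke_jacobian_gradient_psd_bounded[OF fk] clarke_jacobian_gradient_psd_bounded[OF gk]
    unfolding grad_smooth_convex[OF fk] grad_smooth_convex[OF gk] by auto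
  moreover have "norm (rows_on T B *v x) \<le> onorm ((*v) B) * norm x" for x
    unfolding rows_on_mult by (rule order_trans[OF norm_restr_le]) (auto intro: onorm)
  ultimately show ?thesis
    unfolding H Psi_k_modulus_def using \<gamma>
    by (intro psd_bounded_add psd_bounded_scaleR psd_bounded_gram psd_bounded_congruence)
      (auto intro: onorm)
qed

lemma bounded_level_set_Psi_k:
  assumes f: "proper_closed_convex f" and g: "proper_closed_convex g" and \<gamma>: "\<gamma> > 0"
    and co: "coercive_fun f"
  shows "bounded {x. Psi_k f g A B \<gamma> wk T x \<le> c}"
proof -
  define a where "a = QT A B wk /\<^sub>R \<gamma>"
  define b where "b = g_k_grad g \<gamma> (fst wk) 0 v* A"
  \<comment> \<open>The tangent of g_k at 0 may fall with slope \<open>norm b\<close>, and h_k is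
    bounded below. One unit of extra slope from f_k leaves \<open>norm x\<close> to be
    bounded.\<close>
  define K where "K = norm b + 1"
  have K: "K > 0" by (simp add: K_def add_nonneg_pos)
  obtain e where e: "\<And>p. K * norm p - e \<le> moreau_env (1 / \<gamma>) f p"
    using moreau_env_superlinear[OF f co, of "1 / \<gamma>"] \<gamma> by auto
  define C where "C = K * norm a + e + 1 / (2 * \<gamma>) * (norm (QT A B wk))\<^sup>2 - g_k g \<gamma> (fst wk) 0
      + 1 / (2 * \<gamma>) * (norm (snd wk))\<^sup>2"
  have "norm x \<le> c + C" if "Psi_k f g A B \<gamma> wk T x \<le> c" for x
  proof -
    have "K * norm x \<le> K * norm (x - a) + K * norm a"
      using mult_left_mono[OF norm_triangle_ineq[of "x - a" a], of K] K by (simp add: distrib_left)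
    then have 1: "K * norm x - K * norm a - e - 1 / (2 * \<gamma>) * (norm (QT A B wk))\<^sup>2 \<le> f_k f A B \<gamma> wk x"
      using e[of "x - a"] by (simp add: f_k_def a_def)
    have "\<bar>b \<bullet> x\<bar> \<le> norm b * norm x" by (rule Cauchy_Schwarz_ineq2)
    then have 2: "g_k g \<gamma> (fst wk) 0 - norm b * norm x \<le> g_k g \<gamma> (fst wk) (A *v x)"
      using smooth_convexD(1)[OF smooth_convex_g_k[OF g \<gamma>, of "fst wk"], of 0 "A *v x"]
      by (simp add: b_def dot_lmul_matrix)
    have 3: "- (1 / (2 * \<gamma>) * (norm (snd wk))\<^sup>2) \<le> h_k \<gamma> (snd wk) T (B *v x)"
      using \<gamma> by (simp add: h_k_def)
    have "K * norm x = norm b * norm x + norm x" by (simp add: K_def distrib_right)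
    then show ?thesis using 1 2 3 that unfolding Psi_k_def C_def by linarith
  qed
  then show ?thesis unfolding bounded_iff by blast
qed

section \<open>Duality gap and growth of the dual objective\<close>

lemma norm_diff_power2: "(norm (x - y))\<^sup>2 = (norm x)\<^sup>2 - 2 * (x \<bullet> y) + (norm y)\<^sup>2"
  by (simp add: power2_norm_eq_inner inner_diff_left inner_diff_right inner_commute)

lemma Xi_k_real:
  assumes "fenchel_conj f (- QT A B w) = ereal \<alpha>" "fenchel_conj g (fst w) = ereal \<eta>"
  shows "Xi_k f g A B \<gamma> wk w =
    ereal (\<alpha> + \<eta> + 1 / (2 * \<gamma>) * ((norm (QT A B w - QT A B wk))\<^sup>2 + (norm (w - wk))\<^sup>2))"
  using assms by (simp add: Xi_k_def Xi_def inner_Mmap linear_diff[OF linear_QT])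

lemma Xi_k_real_cases:
  assumes g: "proper_fun g" and fin: "\<And>v. fenchel_conj f v = ereal (F v)"
  shows "Xi_k f g A B \<gamma> wk w = \<infinity> \<or> (\<exists>\<eta>. fenchel_conj g (fst w) = ereal \<eta>)"
proof -
  obtain x0 r0 where "g x0 = ereal r0"
    using g unfolding proper_fun_def by (metis ereal_cases)
  then have "ereal (fst w \<bullet> x0 - r0) \<le> fenchel_conj g (fst w)" by (rule fenchel_conj_ge_real)
  then show ?thesis
    by (cases "fenchel_conj g (fst w)") (auto simp: Xi_k_def Xi_def fin)
qed

text \<open>The duality gap splits into the defects in the Fenchel--Young inequalities of the three
  summands of \<open>\<Psi>\<close>, because the pairings \<open>\<langle>x, -Q\<^sup>T w\<rangle>\<close>, \<open>\<langle>A x, y\<rangle>\<close> and \<open>\<langle>B x, z\<rangle>\<close> cancel.\<close>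

lemma gap_identity:
  assumes \<gamma>: "\<gamma> > 0" and w: "w \<in> D_feasible T"
  shows "Psi_k f g A B \<gamma> wk T x
      + (\<alpha> + \<eta> + 1 / (2 * \<gamma>) * ((norm (QT A B w - QT A B wk))\<^sup>2 + (norm (w - wk))\<^sup>2)) =
    (moreau_env (1 / \<gamma>) f (x - QT A B wk /\<^sub>R \<gamma>) + \<alpha> + 1 / (2 * \<gamma>) * (norm (QT A B w))\<^sup>2
        + (x - QT A B wk /\<^sub>R \<gamma>) \<bullet> QT A B w) +
    (moreau_env (1 / \<gamma>) g (A *v x + fst wk /\<^sub>R \<gamma>) + \<eta> + 1 / (2 * \<gamma>) * (norm (fst w))\<^sup>2
        - (A *v x + fst wk /\<^sub>R \<gamma>) \<bullet> fst w) +
    1 / (2 * \<gamma>) * (norm (h_k_grad \<gamma> (snd wk) T (B *v x) - snd w))\<^sup>2"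
proof -
  define \<kappa> where "\<kappa> = 1 / (2 * \<gamma>)"
  have \<kappa>: "inverse \<gamma> = 2 * \<kappa>" by (simp add: \<kappa>_def inverse_eq_divide)
  obtain y z yk zk where w_eq: "w = (y, z)" "wk = (yk, zk)" by (cases w, cases wk)
  define s a where "s = QT A B w" and "a = QT A B wk"
  have z: "restr T z = z" using w by (simp add: D_feasible_iff w_eq)
  have f: "\<kappa> * (norm (s - a))\<^sup>2 - \<kappa> * (norm a)\<^sup>2 = \<kappa> * (norm s)\<^sup>2 + (x - a /\<^sub>R \<gamma>) \<bullet> s - x \<bullet> s"
    by (simp add: norm_diff_power2 inner_diff_left \<kappa> inner_commute[of a] distrib_left right_diff_distrib)
  have g: "\<kappa> * (norm (y - yk))\<^sup>2 - \<kappa> * (norm yk)\<^sup>2 =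
      \<kappa> * (norm y)\<^sup>2 - (A *v x + yk /\<^sub>R \<gamma>) \<bullet> y + (A *v x) \<bullet> y"
    by (simp add: norm_diff_power2 inner_add_left \<kappa> inner_commute[of yk] distrib_left right_diff_distrib)
  have h: "h_k \<gamma> zk T (B *v x) + \<kappa> * (norm (z - zk))\<^sup>2 =
      \<kappa> * (norm (h_k_grad \<gamma> zk T (B *v x) - z))\<^sup>2 + (B *v x) \<bullet> z"
  proof -
    define u where "u = B *v x + zk /\<^sub>R \<gamma>"
    have grad: "h_k_grad \<gamma> zk T (B *v x) = \<gamma> *\<^sub>R restr T u"
      using \<gamma> by (simp add: h_k_grad_def u_def restr_add restr_scaleR scaleR_add_right)
    \<comment> \<open>Feasibility enters here: \<open>z\<close> vanishes off \<open>T\<close>, so it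
      pairs with \<open>restr T u\<close> as with \<open>u\<close>, and <B x, z> appears in
      full.\<close>
    have "restr T u \<bullet> z = u \<bullet> z" by (simp add: inner_restr z)
    then have uz: "restr T u \<bullet> z = (B *v x) \<bullet> z + 2 * \<kappa> * (zk \<bullet> z)"
      by (simp add: u_def inner_add_left \<kappa>)
    have "\<kappa> * (norm (\<gamma> *\<^sub>R restr T u - z))\<^sup>2 =
        \<kappa> * \<gamma>\<^sup>2 * (norm (restr T u))\<^sup>2 - 2 * \<kappa> * \<gamma> * (restr T u \<bullet> z) + \<kappa> * (norm z)\<^sup>2"
      by (simp add: norm_diff_power2 power_mult_distrib distrib_left right_diff_distrib mult_ac)
    moreover have "\<kappa> * \<gamma>\<^sup>2 = \<gamma> / 2" "2 * \<kappa> * \<gamma> = 1"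
      using \<gamma> by (simp_all add: \<kappa>_def power2_eq_square)
    moreover have "\<kappa> * (norm (z - zk))\<^sup>2 = \<kappa> * (norm z)\<^sup>2 - 2 * \<kappa> * (zk \<bullet> z) + \<kappa> * (norm zk)\<^sup>2"
      by (simp add: norm_diff_power2 inner_commute[of zk] distrib_left right_diff_distrib)
    ultimately show ?thesis
      unfolding grad uz h_k_def u_def[symmetric] \<kappa>_def[symmetric] by simp
  qed
  have "x \<bullet> s = (A *v x) \<bullet> y + (B *v x) \<bullet> z"
    unfolding s_def inner_commute[of x] inner_QT w_eq by (simp add: inner_commute)
  moreover have "(norm (w - wk))\<^sup>2 = (norm (y - yk))\<^sup>2 + (norm (z - zk))\<^sup>2"
    by (simp add: w_eq power2_norm_eq_inner)
  ultimately show ?thesis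
    using f g h unfolding Psi_k_def f_k_def g_k_def w_eq fst_conv snd_conv
      s_def[symmetric, unfolded w_eq] a_def[symmetric, unfolded w_eq] \<kappa>_def[symmetric]
    by (simp add: distrib_left)
qed

lemma weak_duality:
  assumes f: "proper_closed_convex f" and g: "proper_closed_convex g" and \<gamma>: "\<gamma> > 0"
    and fin: "\<And>v. fenchel_conj f v = ereal (F v)" and w: "w \<in> D_feasible T"
  shows "ereal (- Psi_k f g A B \<gamma> wk T x) \<le> Xi_k f g A B \<gamma> wk w"
proof (cases "Xi_k f g A B \<gamma> wk w = \<infinity>")
  case False
  then obtain \<eta> where \<eta>: "fenchel_conj g (fst w) = ereal \<eta>"
    using Xi_k_real_cases[OF _ fin, of g A B \<gamma> wk w] g unfolding proper_closed_convex_def by blast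
  have "0 \<le> 1 / (2 * \<gamma>) * (norm (h_k_grad \<gamma> (snd wk) T (B *v x) - snd w))\<^sup>2" using \<gamma> by simp
  then show ?thesis
    using gap_identity[OF \<gamma> w, of f g A B wk x "F (- QT A B w)" \<eta>]
      moreau_env_fenchel_young[OF f \<gamma> fin, of "x - QT A B wk /\<^sub>R \<gamma>" "- QT A B w"]
      moreau_env_fenchel_young[OF g \<gamma> \<eta>, of "A *v x + fst wk /\<^sub>R \<gamma>"]
    unfolding Xi_k_real[OF fin \<eta>] by simp
qed simp

text \<open>At the recovered dual point the defects of \<open>g\<close> and \<open>h\<close> vanish, and the defect of \<open>f\<close> is due
  to the gradient of \<open>\<Psi>\<close> alone.\<close>

lemma Xi_k_dual_recovery:
  fixes f :: "real^'n \<Rightarrow> ereal" and g :: "real^'m \<Rightarrow> ereal"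
    and A :: "real^'n^'m" and B :: "real^'n^'p" and x :: "real^'n" and wk :: "(real^'m) \<times> (real^'p)"
    and T :: "'p set"
  assumes f: "proper_closed_convex f" and g: "proper_closed_convex g" and \<gamma>: "\<gamma> > 0"
    and fin: "\<And>v. fenchel_conj f v = ereal (F v)"
  defines "\<phi> \<equiv> \<lambda>v. F v + 1 / (2 * \<gamma>) * (norm v)\<^sup>2"
    and "v \<equiv> f_k_grad f A B \<gamma> wk x" and "G \<equiv> Psi_k_grad f g A B \<gamma> wk T x"
  shows "Xi_k f g A B \<gamma> wk (dual_recovery g A B \<gamma> wk T x) =
    ereal (\<phi> (v - G) - \<phi> v + (x - QT A B wk /\<^sub>R \<gamma>) \<bullet> G - Psi_k f g A B \<gamma> wk T x)"
proof -
  define w where "w = dual_recovery g A B \<gamma> wk T x"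
  define q where "q = x - QT A B wk /\<^sub>R \<gamma>"
  have w: "fst w = g_k_grad g \<gamma> (fst wk) (A *v x)" "snd w = h_k_grad \<gamma> (snd wk) T (B *v x)"
    unfolding w_def dual_recovery_eq[OF g \<gamma>] by simp_all
  have QTw: "- QT A B w = v - G" by (simp add: v_def G_def Psi_k_grad_def w_def)
  have v: "v = \<gamma> *\<^sub>R (q - prox (1 / \<gamma>) f q)" by (simp add: v_def f_k_grad_def q_def)
  obtain r where "fenchel_conj f v = ereal r"
    "moreau_env (1 / \<gamma>) f q + r + 1 / (2 * \<gamma>) * (norm v)\<^sup>2 = q \<bullet> v"
    using moreau_env_fenchel_eq[OF f \<gamma>, of q] unfolding v[symmetric] by blast
  then have f_eq: "moreau_env (1 / \<gamma>) f q + \<phi> v = q \<bullet> v" by (simp add: fin \<phi>_def)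
  obtain \<eta> where \<eta>: "fenchel_conj g (fst w) = ereal \<eta>"
    "moreau_env (1 / \<gamma>) g (A *v x + fst wk /\<^sub>R \<gamma>) + \<eta> + 1 / (2 * \<gamma>) * (norm (fst w))\<^sup>2
       = (A *v x + fst wk /\<^sub>R \<gamma>) \<bullet> fst w"
    using moreau_env_fenchel_eq[OF g \<gamma>, of "A *v x + fst wk /\<^sub>R \<gamma>"]
    unfolding w(1) g_k_grad_def by blast
  have "w \<in> D_feasible T" unfolding w_def by (rule dual_recovery_feasible)
  from gap_identity[OF \<gamma> this, of f g A B wk x "F (- QT A B w)" \<eta>]
  have "Psi_k f g A B \<gamma> wk T x
      + (F (- QT A B w) + \<eta> + 1 / (2 * \<gamma>) * ((norm (QT A B w - QT A B wk))\<^sup>2 + (norm (w - wk))\<^sup>2))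
    = moreau_env (1 / \<gamma>) f q + F (- QT A B w) + 1 / (2 * \<gamma>) * (norm (- QT A B w))\<^sup>2 - q \<bullet> (- QT A B w)"
    using \<eta>(2) by (simp add: w(2) q_def)
  \<comment> \<open>Equality in Fenchel-Young at \<open>v\<close> eliminates the envelope; moving
    the argument to \<open>v - G\<close> costs the change of \<phi> plus
    \<open>q \<bullet> G\<close>.\<close>
  also have "\<dots> = \<phi> (v - G) - \<phi> v + q \<bullet> G"
    using f_eq unfolding QTw by (simp add: \<phi>_def inner_diff_right)
  finally show ?thesis
    unfolding w_def[symmetric] q_def[symmetric] Xi_k_real[OF fin \<eta>(1)] by simp
qed

text \<open>The conjugates contribute convexity; strong convexity comes from the identity part of M.
  The parallelogram identity gives a quarter of the squared distance, and the factor 1 / (2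
  \<gamma>) makes it 1 / (8 \<gamma>).\<close>

lemma Xi_k_strongly_convex:
  assumes \<gamma>: "\<gamma> > 0" and g: "proper_fun g" and fin: "\<And>v. fenchel_conj f v = ereal (F v)"
    and u: "Xi_k f g A B \<gamma> wk u = ereal r" and w: "Xi_k f g A B \<gamma> wk w = ereal s"
  shows "Xi_k f g A B \<gamma> wk ((1/2) *\<^sub>R u + (1/2) *\<^sub>R w) \<le> ereal ((r + s) / 2 - 1 / (8 * \<gamma>) * (norm (u - w))\<^sup>2)"
proof -
  obtain \<eta> where \<eta>: "fenchel_conj g (fst u) = ereal \<eta>"
    using Xi_k_real_cases[OF g fin, of A B \<gamma> wk u] u by auto
  obtain \<theta> where \<theta>: "fenchel_conj g (fst w) = ereal \<theta>"
    using Xi_k_real_cases[OF g fin, of A B \<gamma> wk w] w by auto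
  define m where "m = (1/2) *\<^sub>R u + (1/2) *\<^sub>R w"
  have lin: "- QT A B m = (1/2) *\<^sub>R (- QT A B u) + (1/2) *\<^sub>R (- QT A B w)"
    unfolding m_def by (simp add: linear_add[OF linear_QT] linear_cmul[OF linear_QT])
  have F: "F (- QT A B m) \<le> (F (- QT A B u) + F (- QT A B w)) / 2"
    using fenchel_conj_convex[OF fin fin, of "1/2" "- QT A B u" "- QT A B w"] unfolding lin fin
    by (simp add: fin)
  have gm: "fenchel_conj g (fst m) \<le> ereal ((\<eta> + \<theta>) / 2)"
    using fenchel_conj_convex[OF \<eta> \<theta>, of "1/2"] by (simp add: m_def add_divide_distrib)
  then have "Xi_k f g A B \<gamma> wk m \<noteq> \<infinity>"
    by (cases "fenchel_conj g (fst m)") (auto simp: Xi_k_def Xi_def fin)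
  then obtain \<rho> where \<rho>: "fenchel_conj g (fst m) = ereal \<rho>" "\<rho> \<le> (\<eta> + \<theta>) / 2"
    using Xi_k_real_cases[OF g fin, of A B \<gamma> wk m] gm by auto
  have par: "(norm ((1/2) *\<^sub>R p + (1/2) *\<^sub>R q - c))\<^sup>2 =
      ((norm (p - c))\<^sup>2 + (norm (q - c))\<^sup>2) / 2 - (norm (p - q))\<^sup>2 / 4" for p q c :: "'x::real_inner"
  proof -
    have "(norm ((1/2) *\<^sub>R p + (1/2) *\<^sub>R q))\<^sup>2 = (norm p)\<^sup>2 / 4 + (p \<bullet> q) / 2 + (norm q)\<^sup>2 / 4"
      by (simp add: power2_norm_eq_inner inner_add_left inner_add_right inner_commute[of q p]
          add_divide_distrib)
    then show ?thesis
      by (simp add: norm_diff_power2 inner_add_left add_divide_distrib diff_divide_distrib)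
  qed
  define P where "P a = (norm (QT A B a - QT A B wk))\<^sup>2 + (norm (a - wk))\<^sup>2" for a
  define \<kappa> where "\<kappa> = 1 / (2 * \<gamma>)"
  have QTm: "QT A B m = (1/2) *\<^sub>R QT A B u + (1/2) *\<^sub>R QT A B w"
    unfolding m_def by (simp add: linear_add[OF linear_QT] linear_cmul[OF linear_QT])
  have "0 \<le> (norm (QT A B u - QT A B w))\<^sup>2" by simp
  then have "P m \<le> P u / 2 + P w / 2 - (norm (u - w))\<^sup>2 / 4"
    using par[of "QT A B u" "QT A B w" "QT A B wk"] par[of u w wk]
    unfolding P_def QTm m_def[symmetric] add_divide_distrib by linarith
  then have "\<kappa> * P m \<le> \<kappa> * (P u / 2 + P w / 2 - (norm (u - w))\<^sup>2 / 4)"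
    using \<gamma> by (intro mult_left_mono) (auto simp: \<kappa>_def)
  also have "\<dots> = \<kappa> * P u / 2 + \<kappa> * P w / 2 - 1 / (8 * \<gamma>) * (norm (u - w))\<^sup>2"
    by (simp add: distrib_left right_diff_distrib \<kappa>_def)
  finally have quad: "\<kappa> * P m \<le> \<kappa> * P u / 2 + \<kappa> * P w / 2 - 1 / (8 * \<gamma>) * (norm (u - w))\<^sup>2" .
  have rs: "r = F (- QT A B u) + \<eta> + \<kappa> * P u" "s = F (- QT A B w) + \<theta> + \<kappa> * P w"
    using u w unfolding Xi_k_real[OF fin \<eta>] Xi_k_real[OF fin \<theta>] P_def \<kappa>_def by simp_all
  have "F (- QT A B m) + \<rho> + \<kappa> * P m \<le> (r + s) / 2 - 1 / (8 * \<gamma>) * (norm (u - w))\<^sup>2"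
    using F \<rho>(2) quad unfolding rs add_divide_distrib by linarith
  then show ?thesis
    unfolding m_def[symmetric] Xi_k_real[OF fin \<rho>(1)] P_def \<kappa>_def by simp
qed

lemma D_feasible_midpoint:
  assumes "u \<in> D_feasible T" "w \<in> D_feasible T"
  shows "(1/2) *\<^sub>R u + (1/2) *\<^sub>R w \<in> D_feasible T"
  using assms by (simp add: D_feasible_iff restr_add restr_scaleR)

text \<open>The midpoint is feasible and cannot beat the minimizer, so strong convexity limits the
  distance. This yields uniqueness, and it turns convergence of values into convergence of
  points.\<close>

lemma Xi_k_quadratic_growth:
  assumes \<gamma>: "\<gamma> > 0" and g: "proper_fun g" and fin: "\<And>v. fenchel_conj f v = ereal (F v)"
    and min: "u \<in> argmins (Xi_k f g A B \<gamma> wk) (D_feasible T)" and u: "Xi_k f g A B \<gamma> wk u = ereal r"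
    and w: "w \<in> D_feasible T" "Xi_k f g A B \<gamma> wk w = ereal s"
  shows "(norm (w - u))\<^sup>2 \<le> 4 * \<gamma> * (s - r)"
proof -
  have "ereal r \<le> Xi_k f g A B \<gamma> wk ((1/2) *\<^sub>R w + (1/2) *\<^sub>R u)"
    using min D_feasible_midpoint[OF w(1), of u] unfolding u[symmetric] argmins_def by blast
  also have "\<dots> \<le> ereal ((s + r) / 2 - 1 / (8 * \<gamma>) * (norm (w - u))\<^sup>2)"
    by (rule Xi_k_strongly_convex[OF \<gamma> g fin w(2) u])
  finally have "1 / (8 * \<gamma>) * (norm (w - u))\<^sup>2 \<le> (s - r) / 2"
    by (simp add: add_divide_distrib diff_divide_distrib)
  then have "8 * \<gamma> * (1 / (8 * \<gamma>) * (norm (w - u))\<^sup>2) \<le> 8 * \<gamma> * ((s - r) / 2)"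
    using \<gamma> by (intro mult_left_mono) auto
  then show ?thesis using \<gamma> by simp
qed

text \<open>As \<open>v\<close> is merely bounded, there is no limit point at which to use
  continuity; uniform continuity on a ball containing both arguments takes its place.\<close>

lemma continuous_diff_tendsto_0:
  fixes \<phi> :: "'a::euclidean_space \<Rightarrow> real"
  assumes \<phi>: "continuous_on UNIV \<phi>" and v: "bounded (range v)" and G: "G \<longlonglongrightarrow> 0"
  shows "(\<lambda>j. \<phi> (v j - G j) - \<phi> (v j)) \<longlonglongrightarrow> 0"
proof -
  obtain R where R: "\<And>j. norm (v j) \<le> R" using v by (auto simp: bounded_iff)
  obtain S where S: "\<And>j. norm (G j) \<le> S"
    using convergent_imp_bounded[OF G] by (auto simp: bounded_iff)
  have S0: "0 \<le> S" using S[of 0] norm_ge_zero order_trans by blast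
  have uc: "uniformly_continuous_on (cball 0 (R + S)) \<phi>"
    by (rule compact_uniformly_continuous[OF continuous_on_subset[OF \<phi>]]) auto
  have ball: "v j - G j \<in> cball 0 (R + S)" "v j \<in> cball 0 (R + S)" for j
    using norm_triangle_ineq4[of "v j" "G j"] R[of j] S[of j] S0 by auto
  have "(\<lambda>j. dist (v j - G j) (v j)) \<longlonglongrightarrow> 0"
    using tendsto_norm[OF G] by (simp add: dist_norm)
  then have "(\<forall>j. v j - G j \<in> cball 0 (R + S)) \<and> (\<forall>j. v j \<in> cball 0 (R + S)) \<and>
      (\<lambda>j. dist (v j - G j) (v j)) \<longlonglongrightarrow> 0"
    by (intro conjI allI ball)
  then have "(\<lambda>j. dist (\<phi> (v j - G j)) (\<phi> (v j))) \<longlonglongrightarrow> 0"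
    by (rule uc[unfolded uniformly_continuous_on_sequentially, THEN spec, THEN spec, THEN mp])
  then show ?thesis by (simp add: dist_real_def tendsto_rabs_zero_iff)
qed

lemma inner_bounded_tendsto_0:
  fixes p G :: "nat \<Rightarrow> 'a::real_inner"
  assumes p: "bounded (range p)" and G: "G \<longlonglongrightarrow> 0"
  shows "(\<lambda>j. p j \<bullet> G j) \<longlonglongrightarrow> 0"
proof -
  obtain R where R: "\<And>j. norm (p j) \<le> R" using p by (auto simp: bounded_iff)
  have lim: "(\<lambda>j. R * norm (G j)) \<longlonglongrightarrow> 0"
    using tendsto_mult_left[OF tendsto_norm[OF G], of R] by simp
  show ?thesis
    by (rule Lim_null_comparison[OF always_eventually lim])
      (auto intro!: order_trans[OF Cauchy_Schwarz_ineq2] mult_right_mono R)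
qed

theorem theorem4:
  fixes f :: "real^'n \<Rightarrow> ereal"
    and g :: "real^'m \<Rightarrow> ereal"
    and A :: "real^'n^'m"
    and B :: "real^'n^('p::{finite,linorder})"
    and \<mu> :: "real^('p::{finite,linorder})"
    and xk :: "real^'n" and yk :: "real^'m" and zk zt :: "real^('p::{finite,linorder})"
    and \<gamma> \<tau> \<tau>1 \<tau>2 \<beta> \<zeta> :: real
    and T :: "('p::{finite,linorder}) set"
    and \<Psi> :: "real^'n \<Rightarrow> real"
    and \<Xi> :: "(real^'m) \<times> (real^('p::{finite,linorder})) \<Rightarrow> ereal"
    and xbar :: "nat \<Rightarrow> real^'n"
    and wbar :: "nat \<Rightarrow> (real^'m) \<times> (real^('p::{finite,linorder}))"
  assumes f: "proper_closed_convex f" and g: "proper_closed_convex g"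
    and coercive: "coercive_fun f"
    and mu: "\<forall>i. \<mu> $ i > 0"
    and gamma: "\<gamma> > 0"
    and Xi: "\<Xi> = Xi_k f g A B \<gamma> (yk, zk)"
    and zt: "coord_min_cycle \<Xi> \<mu> (yk, zk) zt"
    and T: "T = {i. zt $ i \<noteq> 0}"
    and Psi: "\<Psi> = Psi_k f g A B \<gamma> (yk, zk) T"
    and params: "0 < \<tau>" "\<tau> \<le> 1" "0 < \<tau>1" "\<tau>1 < 1" "0 < \<tau>2" "\<tau>2 < 1"
      "0 < \<beta>" "\<beta> < 1" "0 < \<zeta>" "\<zeta> < 1/2"
    and SNA: "SNA_sequence f g A B \<gamma> (yk, zk) T \<tau> \<tau>1 \<tau>2 \<beta> \<zeta> xk (yk, zt) xbar wbar"
  shows "bounded (range (\<lambda>j. (xbar j, wbar j))) \<and>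
    (\<forall>x r. strict_mono r \<and> (xbar \<circ> r) \<longlonglongrightarrow> x \<longrightarrow> x \<in> argmins \<Psi> UNIV) \<and>
    (\<lambda>j. norm (grad \<Psi> (xbar j))) \<longlonglongrightarrow> 0 \<and>
    (\<exists>x. x \<in> argmins \<Psi> UNIV \<and> (\<lambda>j. \<Psi> (xbar j)) \<longlonglongrightarrow> \<Psi> x) \<and>
    (\<lambda>j. duality_gap f g A B \<gamma> (yk, zk) T (xbar j) (wbar j)) \<longlonglongrightarrow> 0 \<and>
    (\<exists>w. argmins \<Xi> (D_feasible T) = {w} \<and> wbar \<longlonglongrightarrow> w \<and> (\<lambda>j. \<Xi> (wbar j)) \<longlonglongrightarrow> \<Xi> w)"
proof -
  let ?wk = "(yk, zk)"
  define L where "L = Psi_k_modulus A B \<gamma>"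
  define D where "D = Psi_k_grad f g A B \<gamma> ?wk T"
  define W where "W = dual_recovery g A B \<gamma> ?wk T"
  define v where "v = f_k_grad f A B \<gamma> ?wk"
  define q where "q x = x - QT A B ?wk /\<^sub>R \<gamma>" for x
  obtain F where fin: "\<And>v. fenchel_conj f v = ereal (F v)"
    using fenchel_conj_finite[OF f coercive] by metis
  define \<phi> where "\<phi> v = F v + 1 / (2 * \<gamma>) * (norm v)\<^sup>2" for v
  \<comment> \<open>This is the dual value at the point recovered from \<open>x\<close>, and it is a
    real number for every \<open>x\<close>.\<close>
  define \<rho> where "\<rho> x = \<phi> (v x - D x) - \<phi> (v x) + q x \<bullet> D x - \<Psi> x" for x
  have L: "L > 0" unfolding L_def by (rule Psi_k_modulus_pos[OF gamma])
  have smooth: "smooth_convex L \<Psi> D"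
    unfolding L_def Psi D_def by (rule smooth_convex_Psi_k[OF f g gamma])
  have grad: "grad \<Psi> = D" by (rule grad_smooth_convex[OF smooth])
  have min_iff: "x \<in> argmins \<Psi> UNIV \<longleftrightarrow> D x = 0" for x
    by (rule smooth_convex_minimizer_iff[OF smooth L])
  have g': "proper_fun g" using g by (simp add: proper_closed_convex_def)
  have step: "\<exists>H d. psd_bounded L H \<and> newton_direction H (D (xbar j)) \<tau> \<tau>1 \<tau>2 d \<and>
      xbar (Suc j) = xbar j + armijo_step \<Psi> \<beta> \<zeta> (xbar j) d *\<^sub>R d" for j
    using SNA gen_hessian_psd_bounded[OF f g gamma]
    unfolding SNA_sequence_def Let_def Psi[symmetric] grad L_def by blast
  have wbar: "wbar j = W (xbar j)" if "j \<ge> 1" for j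
    using SNA that unfolding SNA_sequence_def Let_def W_def by blast
  have level: "bounded {x. \<Psi> x \<le> c}" for c
    unfolding Psi by (rule bounded_level_set_Psi_k[OF f g gamma coercive])
  note conv = newton_armijo_convergence[where x = xbar and \<tau> = \<tau> and ?\<tau>2.0 = \<tau>2, OF smooth L level params(3,7-10) step]
  have accum: "D x = 0" if "strict_mono r" "(xbar \<circ> r) \<longlonglongrightarrow> x" for x r
  proof (rule LIMSEQ_unique)
    show "(\<lambda>j. D ((xbar \<circ> r) j)) \<longlonglongrightarrow> D x"
      using smooth_convex_continuous[OF smooth L, of UNIV] that(2)
      by (rule continuous_on_tendsto_compose) auto
    show "(\<lambda>j. D ((xbar \<circ> r) j)) \<longlonglongrightarrow> 0"
      using LIMSEQ_subseq_LIMSEQ[OF conv(2) that(1)] by (simp add: o_def)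
  qed
  \<comment> \<open>Existence of a primal minimizer comes from the algorithm itself, as an
    accumulation point of its bounded iterates.\<close>
  obtain x r where "strict_mono r" "(xbar \<circ> r) \<longlonglongrightarrow> x"
    using bounded_imp_convergent_subsequence[OF conv(1)] by blast
  then have Dx: "D x = 0" by (rule accum)
  then have x: "x \<in> argmins \<Psi> UNIV" by (simp add: min_iff)
  have \<Psi>_min: "\<Psi> x \<le> \<Psi> z" for z using x by (simp add: argmins_def)
  \<comment> \<open>The tangent at \<open>xbar j\<close>, evaluated at \<open>x\<close>, bounds the
    excess over the minimum by a bounded vector paired with the vanishing gradient. The values
    converge along the full sequence even if the iterates do not.\<close>
  have \<Psi>_lim: "(\<lambda>j. \<Psi> (xbar j)) \<longlonglongrightarrow> \<Psi> x"
  proof (rule tendsto_sandwich[OF _ _ tendsto_const])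
    have "bounded (range (\<lambda>j. xbar j - x))"
      using bounded_minus_comp[OF conv(1), of "\<lambda>_. x"] by simp
    from tendsto_add[OF tendsto_const inner_bounded_tendsto_0[OF this conv(2)], of "\<Psi> x"]
    show "(\<lambda>j. \<Psi> x + (xbar j - x) \<bullet> D (xbar j)) \<longlonglongrightarrow> \<Psi> x" by simp
    show "\<forall>\<^sub>F j in sequentially. \<Psi> (xbar j) \<le> \<Psi> x + (xbar j - x) \<bullet> D (xbar j)"
    proof (intro always_eventually allI)
      fix j
      show "\<Psi> (xbar j) \<le> \<Psi> x + (xbar j - x) \<bullet> D (xbar j)"
        using smooth_convexD(1)[OF smooth, of "xbar j" x]
        by (simp add: inner_diff_left inner_diff_right inner_commute)
    qed
  qed (use \<Psi>_min in auto)
  have \<Xi>_W: "\<Xi> (W z) = ereal (\<rho> z)" for z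
    unfolding Xi W_def \<rho>_def \<phi>_def v_def D_def q_def Psi
    by (rule Xi_k_dual_recovery[OF f g gamma fin])
  have gap_lim: "(\<lambda>j. \<Psi> (xbar j) + \<rho> (xbar j)) \<longlonglongrightarrow> 0"
  proof -
    obtain R where R: "\<And>j. norm (xbar j) \<le> R" using conv(1) by (auto simp: bounded_iff)
    have "norm (v (xbar j)) \<le> norm (v 0) + \<gamma> * R" for j
    proof -
      have "norm (v (xbar j) - v 0) \<le> \<gamma> * norm (xbar j - 0)"
        unfolding v_def by (rule smooth_convex_lipschitz[OF smooth_convex_f_k[OF f gamma] gamma])
      also have "\<dots> \<le> \<gamma> * R" using R[of j] gamma by simp
      finally show ?thesis using norm_triangle_ineq[of "v (xbar j) - v 0" "v 0"] by simp
    qed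
    then have bv: "bounded (range (\<lambda>j. v (xbar j)))" unfolding bounded_iff by blast
    have bq: "bounded (range (\<lambda>j. q (xbar j)))"
      using bounded_minus_comp[OF conv(1), of "\<lambda>_. QT A B ?wk /\<^sub>R \<gamma>"] by (simp add: q_def)
    have "continuous_on UNIV \<phi>"
      unfolding \<phi>_def by (intro continuous_intros fenchel_conj_continuous[OF fin])
    from tendsto_add[OF continuous_diff_tendsto_0[OF this bv conv(2)] inner_bounded_tendsto_0[OF bq conv(2)]]
    have "(\<lambda>j. (\<phi> (v (xbar j) - D (xbar j)) - \<phi> (v (xbar j))) + q (xbar j) \<bullet> D (xbar j)) \<longlonglongrightarrow> 0"
      by simp
    moreover have "(\<phi> (v z - D z) - \<phi> (v z)) + q z \<bullet> D z = \<Psi> z + \<rho> z" for z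
      by (simp add: \<rho>_def)
    ultimately show ?thesis by (simp only:)
  qed
  \<comment> \<open>With zero gradient the gap closes exactly, so weak duality makes
    \<open>W x\<close> a dual minimizer.\<close>
  have \<rho>_x: "\<rho> x = - \<Psi> x" by (simp add: \<rho>_def Dx)
  have \<rho>_lim: "(\<lambda>j. \<rho> (xbar j)) \<longlonglongrightarrow> \<rho> x"
    using tendsto_diff[OF gap_lim \<Psi>_lim] by (simp add: \<rho>_x)
  have W_feasible: "W z \<in> D_feasible T" for z unfolding W_def by (rule dual_recovery_feasible)
  have W_min: "W x \<in> argmins \<Xi> (D_feasible T)"
    using weak_duality[OF f g gamma fin, of _ T A B ?wk x] W_feasible
    unfolding argmins_def Xi[symmetric] Psi[symmetric] by (simp add: \<Xi>_W \<rho>_x)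
  have growth: "(norm (w - W x))\<^sup>2 \<le> 4 * \<gamma> * (s - \<rho> x)"
    if "w \<in> D_feasible T" "\<Xi> w = ereal s" for w s
    using Xi_k_quadratic_growth[OF gamma g' fin W_min[unfolded Xi] \<Xi>_W[unfolded Xi]] that
    unfolding Xi by blast
  have unique: "argmins \<Xi> (D_feasible T) = {W x}"
  proof (intro equalityI subsetI)
    fix w assume w: "w \<in> argmins \<Xi> (D_feasible T)"
    then have "\<Xi> w = ereal (\<rho> x)"
      using W_min by (auto simp: argmins_def \<Xi>_W[symmetric] intro: antisym)
    then show "w \<in> {W x}" using growth[of w "\<rho> x"] w by (simp add: argmins_def)
  qed (use W_min in simp)
  \<comment> \<open>Index 0 may still hold the initial dual point, so all dual limits are first
    taken along the recovered points.\<close>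
  have eventually_wbar: "\<forall>\<^sub>F j in sequentially. W (xbar j) = wbar j"
    using eventually_ge_at_top[of 1] by (rule eventually_mono) (simp add: wbar)
  have W_lim: "(\<lambda>j. W (xbar j)) \<longlonglongrightarrow> W x"
  proof -
    \<comment> \<open>Quadratic growth at the feasible points \<open>W (xbar j)\<close> bounds their
      distance to \<open>W x\<close> by this square root.\<close>
    have "(\<lambda>j. sqrt (4 * \<gamma> * (\<rho> (xbar j) - \<rho> x))) \<longlonglongrightarrow> sqrt (4 * \<gamma> * (\<rho> x - \<rho> x))"
      by (intro tendsto_intros \<rho>_lim)
    then have lim: "(\<lambda>j. sqrt (4 * \<gamma> * (\<rho> (xbar j) - \<rho> x))) \<longlonglongrightarrow> 0" by simp
    have "(\<lambda>j. W (xbar j) - W x) \<longlonglongrightarrow> 0"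
      by (rule Lim_null_comparison[OF always_eventually lim])
        (auto intro!: real_le_rsqrt growth W_feasible \<Xi>_W)
    then show ?thesis by (rule LIM_zero_cancel)
  qed
  have wbar_lim: "wbar \<longlonglongrightarrow> W x"
    using W_lim eventually_wbar by (rule Lim_transform_eventually)
  have "bounded (range xbar \<times> range wbar)"
    by (rule bounded_Times[OF conv(1) convergent_imp_bounded[OF wbar_lim]])
  then have "bounded (range (\<lambda>j. (xbar j, wbar j)))"
    by (rule bounded_subset) auto
  moreover have "\<forall>x r. strict_mono r \<and> (xbar \<circ> r) \<longlonglongrightarrow> x \<longrightarrow> x \<in> argmins \<Psi> UNIV"
    using accum unfolding min_iff by blast
  moreover have "(\<lambda>j. norm (grad \<Psi> (xbar j))) \<longlonglongrightarrow> 0"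
    using tendsto_norm[OF conv(2)] by (simp add: grad)
  moreover have "(\<lambda>j. duality_gap f g A B \<gamma> ?wk T (xbar j) (wbar j)) \<longlonglongrightarrow> 0"
  proof (rule Lim_transform_eventually)
    show "(\<lambda>j. ereal (\<Psi> (xbar j) + \<rho> (xbar j))) \<longlonglongrightarrow> 0"
      using tendsto_ereal[OF gap_lim] by (simp add: zero_ereal_def)
    show "\<forall>\<^sub>F j in sequentially. ereal (\<Psi> (xbar j) + \<rho> (xbar j)) =
        duality_gap f g A B \<gamma> ?wk T (xbar j) (wbar j)"
      using eventually_wbar
    proof eventually_elim
      case (elim j)
      show ?case
        unfolding duality_gap_def Psi[symmetric] Xi[symmetric] elim[symmetric] \<Xi>_W by simp
    qed
  qed
  moreover have "(\<lambda>j. \<Xi> (wbar j)) \<longlonglongrightarrow> \<Xi> (W x)"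
  proof (rule Lim_transform_eventually)
    show "(\<lambda>j. \<Xi> (W (xbar j))) \<longlonglongrightarrow> \<Xi> (W x)"
      unfolding \<Xi>_W by (rule tendsto_ereal[OF \<rho>_lim])
    show "\<forall>\<^sub>F j in sequentially. \<Xi> (W (xbar j)) = \<Xi> (wbar j)"
      using eventually_wbar by eventually_elim simp
  qed
  ultimately show ?thesis using x \<Psi>_lim unique wbar_lim by blast
qed

end
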